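(* Assume $d\ge3$, $n\ge1$ and $0<C\le C_*(d)$. Then $$\inf_{\rho\in\mathfrak M_d:\,\chi_*(\rho)\le C}\ \sup_{\theta\in\Delta_d}R^{\mathrm{iid}}_\theta(\rho)=\frac{(d-1)(d+2\sqrt{d-1})}{nd\,C},$$ $$\inf_{\rho\in\mathfrak M_d:\,\chi_*(\rho)\le C}\ \sup_{\theta}R^{\mathrm{fc}}_\theta(\rho)=\frac1n\Big[\frac{(d-1)(d+2\sqrt{d-1})}{d\,C}-\frac{d-1}{d}\Big],$$ where in the second line the supremum is over $\theta\in\Delta_d$ with all $n\theta_i$ integers. Both infima are attained by $\rho_{p,\lambda_*}$ with $p=C/C_*(d)$, and in each case $\rho_{p,\lambda_*}$ is the unique minimizer.
   Context: Fix $d\ge3$. Let $H\in\mathbb R^{d\times(d-1)}$ have orthonormal columns spanning $\{u\in\mathbb R^d:\mathbf 1^\top u=0\}$, $\gamma_i:=H^\top e_i$, $\mathcal X_d:=\{x\in\mathbb R^{d-1}:1+\gamma_i^\top x\ge0\ \forall i\}$, $\Delta_d$ the probability simplex, $h_\theta:=\sum_i\theta_i\gamma_i$. An anchored law is a Borel probability measure $\rho$ on $\mathcal X_d$ with $\int x\,\rho(dx)=0$; $\mathfrak M_d$ is the set of anchored laws; $W_\rho(B\mid i):=\int_B(1+\gamma_i^\top x)\rho(dx)$; $\Sigma(\rho):=\int xx^\top\rho(dx)$. Canonical estimator $\widehat\theta_\rho:=\mathbf 1/d+H\Sigma(\rho)^{-1}\bar X$, $\bar X:=\frac1n\sum_mX_m$.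 $R^{\mathrm{iid}}_\theta(\rho):=\mathbb E\|\widehat\theta_\rho-\theta\|^2$ when $X_1,\dots,X_n$ are i.i.d. with law $(1+h_\theta^\top x)\rho(dx)$; $R^{\mathrm{fc}}_\theta(\rho):=\mathbb E\|\widehat\theta_\rho-\theta\|^2$ when ($n\theta_i\in\mathbb Z$) the $X_m$ are independent with exactly $n\theta_i$ drawn from $W_\rho(\cdot\mid i)$; both are $+\infty$ when $\Sigma(\rho)$ is singular. Budget: $\chi_*(\rho):=\max_{i\ne j}\int\frac{((\gamma_j-\gamma_i)^\top x)^2}{1+\gamma_i^\top x}\rho(dx)$ (integrand $0$ where $1+\gamma_i^\top x=0=(\gamma_j-\gamma_i)^\top x$, $+\infty$ where $1+\gamma_i^\top x=0\ne(\gamma_j-\gamma_i)^\top x$). For $\lambda>1$, $p\in[0,1]$: $t_\lambda:=\frac{d(\lambda-1)}{d+\lambda-1}$, $\rho_{p,\lambda}:=(1-p)\delta_0+\frac pd\sum_i\delta_{t_\lambda\gamma_i}$; $\lambda_*:=\sqrt{d-1}$, $C_*(d):=\frac{(\lambda_*-1)^2(\lambda_*+1)}{\lambda_*(d+\lambda_*-1)}$. *)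

theory Defs
  imports "HOL-Probability.Probability"
begin

text \<open>Index type 'i has d = CARD('i) elements (coordinates of R^d);
  type 'k has d-1 elements (coordinates of R^(d-1)).
  H :: real^'k^'i is a d x (d-1) matrix.\<close>

definition valid_H :: "real^'k^'i \<Rightarrow> bool" where
  "valid_H H \<longleftrightarrow> transpose H ** H = mat 1 \<and>
     range (\<lambda>x. H *v x) = {u :: real^'i. (\<Sum>i\<in>UNIV. u $ i) = 0}"

definition gam :: "real^'k^'i \<Rightarrow> 'i \<Rightarrow> real^'k" where
  "gam H i = transpose H *v axis i 1"

definition Xd :: "real^'k^'i \<Rightarrow> (real^'k) set" where
  "Xd H = {x. \<forall>i. 1 + gam H i \<bullet> x \<ge> 0}"

definition prob_simplex :: "(real^'i) set" where
  "prob_simplex = {\<theta>. (\<forall>i. 0 \<le> \<theta> $ i) \<and> (\<Sum>i\<in>UNIV. \<theta> $ i) = 1}"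

definition hvec :: "real^'k^'i \<Rightarrow> real^'i \<Rightarrow> real^'k" where
  "hvec H \<theta> = (\<Sum>i\<in>UNIV. \<theta> $ i *\<^sub>R gam H i)"

definition anchored :: "real^'k^'i \<Rightarrow> (real^'k) measure set" where
  "anchored H = {\<rho>. prob_space \<rho> \<and> sets \<rho> = sets borel \<and>
      emeasure \<rho> (- Xd H) = 0 \<and> integrable \<rho> (\<lambda>x. x) \<and> (\<integral>x. x \<partial>\<rho>) = 0}"

definition Wlaw :: "real^'k^'i \<Rightarrow> (real^'k) measure \<Rightarrow> 'i \<Rightarrow> (real^'k) measure" where
  "Wlaw H \<rho> i = density \<rho> (\<lambda>x. ennreal (1 + gam H i \<bullet> x))"

definition Sigma_mat :: "(real^'k) measure \<Rightarrow> real^'k^'k" where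
  "Sigma_mat \<rho> = (\<chi> a b. \<integral>x. x $ a * x $ b \<partial>\<rho>)"

definition est :: "real^'k^'i \<Rightarrow> (real^'k) measure \<Rightarrow> nat \<Rightarrow> (nat \<Rightarrow> real^'k) \<Rightarrow> real^'i" where
  "est H \<rho> n X = (\<chi> i. 1 / real CARD('i)) +
     H *v (matrix_inv (Sigma_mat \<rho>) *v ((1 / real n) *\<^sub>R (\<Sum>m<n. X m)))"

definition R_iid :: "real^'k^'i \<Rightarrow> nat \<Rightarrow> real^'i \<Rightarrow> (real^'k) measure \<Rightarrow> ereal" where
  "R_iid H n \<theta> \<rho> =
     (if \<not> invertible (Sigma_mat \<rho>) then \<infinity>
      else ereal (\<integral>X. (norm (est H \<rho> n X - \<theta>))\<^sup>2
        \<partial>(PiM {..<n} (\<lambda>_. density \<rho> (\<lambda>x. ennreal (1 + hvec H \<theta> \<bullet> x))))))"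

text \<open>Fixed-composition design: a labelling c of the n sample slots with
  exactly n*theta_i slots labelled i (the risk does not depend on which one).\<close>
definition labelling :: "nat \<Rightarrow> real^'i \<Rightarrow> nat \<Rightarrow> 'i" where
  "labelling n \<theta> = (SOME c. \<forall>i. real (card {m\<in>{..<n}. c m = i}) = real n * \<theta> $ i)"

definition R_fc :: "real^'k^'i \<Rightarrow> nat \<Rightarrow> real^'i \<Rightarrow> (real^'k) measure \<Rightarrow> ereal" where
  "R_fc H n \<theta> \<rho> =
     (if \<not> invertible (Sigma_mat \<rho>) then \<infinity>
      else ereal (\<integral>X. (norm (est H \<rho> n X - \<theta>))\<^sup>2
        \<partial>(PiM {..<n} (\<lambda>m. Wlaw H \<rho> (labelling n \<theta> m)))))"

definition fc_simplex :: "nat \<Rightarrow> (real^'i) set" where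
  "fc_simplex n = {\<theta>\<in>prob_simplex. \<forall>i. real n * \<theta> $ i \<in> \<int>}"

definition chi_integrand :: "real^'k^'i \<Rightarrow> 'i \<Rightarrow> 'i \<Rightarrow> real^'k \<Rightarrow> ennreal" where
  "chi_integrand H i j x =
     (if 1 + gam H i \<bullet> x = 0 then (if (gam H j - gam H i) \<bullet> x = 0 then 0 else \<infinity>)
      else ennreal (((gam H j - gam H i) \<bullet> x)\<^sup>2 / (1 + gam H i \<bullet> x)))"

definition chi_star :: "real^'k^'i \<Rightarrow> (real^'k) measure \<Rightarrow> ennreal" where
  "chi_star H \<rho> = (SUP ij\<in>{(i,j). i \<noteq> j}. \<integral>\<^sup>+ x. chi_integrand H (fst ij) (snd ij) x \<partial>\<rho>)"

definition t_lam :: "nat \<Rightarrow> real \<Rightarrow> real" where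
  "t_lam d lam = real d * (lam - 1) / (real d + lam - 1)"

definition rho_pl :: "real^'k^'i \<Rightarrow> real \<Rightarrow> real \<Rightarrow> (real^'k) measure" where
  "rho_pl H p lam = distr (measure_pmf (
      bernoulli_pmf p \<bind> (\<lambda>b. if b then map_pmf (\<lambda>i. t_lam CARD('i) lam *\<^sub>R gam H i) (pmf_of_set UNIV)
                              else return_pmf 0))) borel (\<lambda>x. x)"

definition lam_star :: "nat \<Rightarrow> real" where
  "lam_star d = sqrt (real d - 1)"

definition C_star :: "nat \<Rightarrow> real" where
  "C_star d = (lam_star d - 1)\<^sup>2 * (lam_star d + 1) / (lam_star d * (real d + lam_star d - 1))"

end

theory Submission
  imports Defs
begin

text \<open>
  Write \<open>y\<^sub>i = 1 + \<gamma>\<^sub>i \<bullet> x\<close> and \<open>s = sqrt (d - 1)\<close>. The estimator is unbiased, so both risks reduce to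
  \<open>\<integral> |\<Sigma>\<^sup>-\<^sup>1 x|\<^sup>2 (1 + h \<bullet> x) d\<rho>\<close> minus an explicit term. Averaging over \<open>\<theta>\<close> (the barycentre for the i.i.d.
  design, the vertices for the fixed-composition design) bounds the worst case below by
  \<open>tr \<Sigma>\<^sup>-\<^sup>1\<close>, hence by \<open>(d - 1)\<^sup>2 / \<integral> |x|\<^sup>2 d\<rho>\<close>. Averaging the budget over all pairs bounds
  \<open>\<integral> |x|\<^sup>2 d\<rho>\<close>, because pointwise
  \<open>\<Sum>\<^sub>i\<^sub>j (y\<^sub>j - y\<^sub>i)\<^sup>2 / y\<^sub>i \<ge> (d + 2 s) |x|\<^sup>2\<close>, with equality only at \<open>x = 0\<close> and \<open>x = t \<gamma>\<^sub>i\<close>. So an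
  optimal law lives on these \<open>d + 1\<close> points; its zero mean makes the weights of the \<open>t \<gamma>\<^sub>i\<close> equal and
  its second moment fixes their value.
\<close>

subsection \<open>Simplex geometry and the pointwise inequality\<close>

lemma matrix_vector_nth_gam: "(H *v x) $ i = gam H i \<bullet> x"
proof -
  have "gam H i \<bullet> x = axis i 1 \<bullet> (H *v x)"
    unfolding gam_def by (simp add: dot_lmul_matrix transpose_matrix_vector)
  then show ?thesis by (simp add: inner_axis')
qed

lemma transpose_mult_eq_sum_gam: "transpose H *v u = (\<Sum>i\<in>UNIV. u $ i *\<^sub>R gam H i)"
proof -
  have "u = (\<Sum>i\<in>UNIV. u $ i *\<^sub>R axis i 1)"
    using basis_expansion[of u] by (simp add: scalar_mult_eq_scaleR)
  then have "transpose H *v u = transpose H *v (\<Sum>i\<in>UNIV. u $ i *\<^sub>R axis i 1)" by simp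
  also have "\<dots> = (\<Sum>i\<in>UNIV. u $ i *\<^sub>R gam H i)"
    by (simp add: gam_def linear_sum linear_scale matrix_vector_mul_linear del: transpose_matrix_vector)
  finally show ?thesis .
qed

context
  fixes H :: "real^'k^'i"
  assumes valid: "valid_H H"
begin

lemma transpose_mult_cancel: "transpose H *v (H *v x) = x"
  using valid by (simp add: valid_H_def matrix_vector_mul_assoc del: transpose_matrix_vector)

text \<open>The relation \<open>transpose H ** H = mat 1\<close> read as a resolution of the
  identity: the vectors \<open>gam H i\<close> form a Parseval frame, so a point is recovered from
  its coordinates.\<close>

lemma expand_gam: "x = (\<Sum>i\<in>UNIV. (gam H i \<bullet> x) *\<^sub>R gam H i)"
  using transpose_mult_eq_sum_gam[of H "H *v x"]
  by (simp add: transpose_mult_cancel matrix_vector_nth_gam del: transpose_matrix_vector)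

lemma inner_mult_H: "(H *v x) \<bullet> (H *v y) = x \<bullet> y"
proof -
  have "(H *v x) \<bullet> (H *v y) = (transpose H *v (H *v x)) \<bullet> y"
    by (simp add: dot_lmul_matrix)
  then show ?thesis by (simp add: transpose_mult_cancel del: transpose_matrix_vector)
qed

lemma norm_mult_H: "norm (H *v x) = norm x"
  by (simp add: norm_eq_sqrt_inner inner_mult_H)

lemma sum_gam_inner: "(\<Sum>i\<in>UNIV. gam H i \<bullet> x) = 0"
proof -
  have "H *v x \<in> {u. (\<Sum>i\<in>UNIV. u $ i) = 0}"
    using valid unfolding valid_H_def by blast
  then show ?thesis by (simp add: matrix_vector_nth_gam)
qed

lemma sum_gam: "(\<Sum>i\<in>UNIV. gam H i) = 0"
proof -
  have "(\<Sum>i\<in>UNIV. gam H i) \<bullet> (\<Sum>i\<in>UNIV. gam H i) = 0"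
    by (subst inner_sum_left) (rule sum_gam_inner)
  then show ?thesis by simp
qed

lemma sum_gam_inner_sq: "(\<Sum>i\<in>UNIV. (gam H i \<bullet> x)\<^sup>2) = (norm x)\<^sup>2"
proof -
  have "(norm x)\<^sup>2 = (H *v x) \<bullet> (H *v x)" by (simp add: inner_mult_H power2_norm_eq_inner)
  then show ?thesis by (simp add: inner_vec_def matrix_vector_nth_gam power2_eq_square)
qed

text \<open>\<open>H ** transpose H\<close> is the orthogonal projection onto the zero-sum
  hyperplane, which is the range of \<open>H\<close>.\<close>

lemma mult_H_transpose:
  assumes "(\<Sum>i\<in>UNIV. u $ i) = 0"
  shows "H *v (transpose H *v u) = u"
proof -
  have "u \<in> range (\<lambda>x. H *v x)" using valid assms by (simp add: valid_H_def)
  then show ?thesis by (auto simp: transpose_mult_cancel simp del: transpose_matrix_vector)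
qed

text \<open>\<open>transpose H\<close> annihilates constant vectors because the
  \<open>gam H i\<close> sum to zero, so \<theta> and its centred version have the same image
  \<open>hvec H \<theta>\<close>; \<open>H\<close> then recovers the centred vector.\<close>

lemma mult_H_hvec:
  assumes "(\<Sum>i\<in>UNIV. \<theta> $ i) = 1"
  shows "H *v hvec H \<theta> = \<theta> - (\<chi> i. 1 / real CARD('i))"
proof -
  let ?u = "\<theta> - (\<chi> i. 1 / real CARD('i))"
  have "transpose H *v ?u = hvec H \<theta>"
    unfolding transpose_mult_eq_sum_gam hvec_def
    by (simp add: scaleR_diff_left sum_subtractf sum_gam flip: scaleR_sum_right)
  moreover have "(\<Sum>i\<in>UNIV. ?u $ i) = 0"
    using assms by (simp add: sum_subtractf)
  ultimately show ?thesis using mult_H_transpose[of ?u] by simp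
qed

lemma hvec_axis: "hvec H (axis i 1) = gam H i"
proof -
  have "hvec H (axis i 1) = (\<Sum>j\<in>UNIV. if j = i then gam H j else 0)"
    unfolding hvec_def by (intro sum.cong refl) (auto simp: axis_def)
  then show ?thesis by simp
qed

text \<open>These are the entries of the projection onto the zero-sum hyperplane: the
  \<open>gam H i\<close> are the vertices of a regular simplex. They are read off from
  \<open>mult_H_hvec\<close> at a vertex of the probability simplex.\<close>

lemma inner_gam:
  "gam H i \<bullet> gam H j = (if i = j then 1 else 0) - 1 / real CARD('i)"
proof -
  have "(\<Sum>k\<in>UNIV. (axis j 1 :: real^'i) $ k) = 1" by (simp add: axis_def)
  from mult_H_hvec[OF this] have "H *v gam H j = axis j 1 - (\<chi> i. 1 / real CARD('i))"
    by (simp add: hvec_axis)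
  then show ?thesis
    using matrix_vector_nth_gam[of H "gam H j" i] by (auto simp: axis_def)
qed

lemma gam_nonzero:
  assumes "2 \<le> CARD('i)"
  shows "gam H i \<noteq> 0"
proof
  assume "gam H i = 0"
  then have "gam H i \<bullet> gam H i = 0" by simp
  then show False using assms by (simp add: inner_gam field_simps)
qed

lemma hvec_uniform: "hvec H (\<chi> i. 1 / real CARD('i)) = 0"
  unfolding hvec_def by (simp add: sum_gam flip: scaleR_sum_right)

end

lemma closed_Xd: "closed (Xd H)"
  unfolding Xd_def by (intro closed_Collect_all closed_Collect_le continuous_intros)

lemma uniform_in_prob_simplex: "(\<chi> i::'i. 1 / real CARD('i)) \<in> (prob_simplex :: (real^'i::finite) set)"
  by (simp add: prob_simplex_def)

lemma axis_in_prob_simplex: "axis i 1 \<in> prob_simplex"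
  by (auto simp: prob_simplex_def axis_def)

lemma hvec_inner: "hvec H \<theta> \<bullet> x = (\<Sum>i\<in>UNIV. \<theta> $ i * (gam H i \<bullet> x))"
  by (simp add: hvec_def inner_sum_left)

text \<open>The tilt is a convex combination of the numbers \<open>1 + gam H i \<bullet> x\<close>,
  which are nonnegative on \<open>Xd H\<close>.\<close>

lemma hvec_tilt_nonneg:
  assumes "\<theta> \<in> prob_simplex" "x \<in> Xd H"
  shows "0 \<le> 1 + hvec H \<theta> \<bullet> x"
proof -
  have "1 + hvec H \<theta> \<bullet> x = (\<Sum>i\<in>UNIV. \<theta> $ i * (1 + gam H i \<bullet> x))"
    using assms(1) by (simp add: hvec_inner prob_simplex_def distrib_left sum.distrib)
  also have "\<dots> \<ge> 0" using assms by (intro sum_nonneg) (auto simp: prob_simplex_def Xd_def)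
  finally show ?thesis .
qed

section \<open>Sharp lower bound for the pairwise chi-square sum\<close>

lemma pairwise_sum_expand:
  fixes y :: "'i::finite \<Rightarrow> real"
  assumes pos: "\<And>i. 0 < y i" and tot: "(\<Sum>i\<in>UNIV. y i) = real CARD('i)"
  shows "(\<Sum>i\<in>UNIV. \<Sum>j\<in>UNIV. (y j - y i)\<^sup>2 / y i)
     = (\<Sum>i\<in>UNIV. (y i)\<^sup>2) * (\<Sum>i\<in>UNIV. 1 / y i) - (real CARD('i))\<^sup>2"
proof -
  let ?Q = "\<Sum>i\<in>UNIV. (y i)\<^sup>2" and ?d = "real CARD('i)"
  \<comment> \<open>Expanding the square decouples the indices: only \<open>?Q\<close> meets a
    reciprocal, and the other terms are controlled by the fixed total.\<close>
  have "(\<Sum>j\<in>UNIV. (y j - y i)\<^sup>2 / y i) = ?Q * (1 / y i) - 2 * ?d + ?d * y i" for i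
  proof -
    have "(y j - y i)\<^sup>2 / y i = (y j)\<^sup>2 * (1 / y i) - 2 * y j + y i" for j
      using pos[of i] by (simp add: field_simps power2_eq_square)
    then have "(\<Sum>j\<in>UNIV. (y j - y i)\<^sup>2 / y i) = (\<Sum>j\<in>UNIV. (y j)\<^sup>2 * (1 / y i) - 2 * y j + y i)"
      by simp
    also have "\<dots> = ?Q * (1 / y i) - 2 * ?d + ?d * y i"
      unfolding sum.distrib sum_subtractf using tot
      by (simp flip: sum_distrib_right sum_distrib_left sum_divide_distrib)
    finally show ?thesis .
  qed
  then have "(\<Sum>i\<in>UNIV. \<Sum>j\<in>UNIV. (y j - y i)\<^sup>2 / y i)
      = (\<Sum>i\<in>UNIV. ?Q * (1 / y i) - 2 * ?d + ?d * y i)" by simp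
  also have "\<dots> = ?Q * (\<Sum>i\<in>UNIV. 1 / y i) - ?d * (2 * ?d) + ?d * ?d"
    unfolding sum.distrib sum_subtractf using tot
    by (simp flip: sum_distrib_right sum_distrib_left del: times_divide_eq_right mult_1_right)
  finally show ?thesis by (simp add: power2_eq_square)
qed

text \<open>\<open>a\<close> is the largest coordinate, \<open>b\<close> the mean of the \<open>m\<close> others and \<open>V\<close> their squared deviation.\<close>
lemma gap_identity:
  fixes a b s m d V :: real
  assumes "0 < a" "0 < b" "a + m * b = d" "m = d - 1" "s\<^sup>2 = m" "0 < d"
  shows "(a\<^sup>2 + m * b\<^sup>2 + V) * (1 / a + m / b + V / (b\<^sup>2 * a) - d - 2 * s) + 2 * s * d
     = m * (a - b)\<^sup>2 * (a - s * b)\<^sup>2 / (d * a * b)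
       + V * ((a - s * b)\<^sup>2 / (a * b) + (a - b) / b\<^sup>2) + V\<^sup>2 / (b\<^sup>2 * a)"
proof -
  \<comment> \<open>With \<open>m\<close> and \<open>d\<close> written through \<open>s\<close>, a
    single relation between \<open>a\<close>, \<open>b\<close> and \<open>s\<close> remains; the
    polynomial identities below hold modulo it.\<close>
  have rel: "a + s\<^sup>2 * b = s\<^sup>2 + 1" "d = s\<^sup>2 + 1" "m = s\<^sup>2" using assms by auto
  have p: "0 < s\<^sup>2 + 1" by (simp add: add_nonneg_pos)
  \<comment> \<open>The part free of \<open>V\<close>, that is, the case in which all coordinates
    but the largest equal \<open>b\<close>.\<close>
  have c0: "(a\<^sup>2 + m * b\<^sup>2) * (1 / a + m / b - d - 2 * s) + 2 * s * d
      = m * (a - b)\<^sup>2 * (a - s * b)\<^sup>2 / (d * a * b)"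
  proof -
    have "((a\<^sup>2 + s\<^sup>2 * b\<^sup>2) * (b + s\<^sup>2 * a - (s\<^sup>2 + 1) * (a * b) - 2 * s * (a * b))
        + 2 * s * (s\<^sup>2 + 1) * (a * b)) * (s\<^sup>2 + 1)
      = s\<^sup>2 * (a - b)\<^sup>2 * (a - s * b)\<^sup>2"
      using rel(1) by algebra
    then show ?thesis using assms(1,2) p unfolding rel(2,3)
      by (simp add: divide_simps)
  qed
  \<comment> \<open>The coefficient of \<open>V\<close>; that of \<open>V\<^sup>2\<close> is
    \<open>1 / (b\<^sup>2 * a)\<close> at sight.\<close>
  have c1: "1 / a + m / b - d - 2 * s + (a\<^sup>2 + m * b\<^sup>2) / (b\<^sup>2 * a)
      = (a - s * b)\<^sup>2 / (a * b) + (a - b) / b\<^sup>2"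
  proof -
    have ne: "a \<noteq> 0" "b \<noteq> 0" using assms(1,2) by auto
    have "b\<^sup>2 + s\<^sup>2 * a * b - (s\<^sup>2 + 1 + 2 * s) * (a * b\<^sup>2) + (a\<^sup>2 + s\<^sup>2 * b\<^sup>2)
      = (a - s * b)\<^sup>2 * b + (a - b) * a" (is "?l = ?r")
      using rel(1) by algebra
    then have "?l / (b\<^sup>2 * a) = ?r / (b\<^sup>2 * a)" by simp
    moreover have "?l / (b\<^sup>2 * a) = 1 / a + m / b - d - 2 * s + (a\<^sup>2 + m * b\<^sup>2) / (b\<^sup>2 * a)"
      unfolding rel(2,3) using ne by (simp add: field_simps power2_eq_square)
    moreover have "?r / (b\<^sup>2 * a) = (a - s * b)\<^sup>2 / (a * b) + (a - b) / b\<^sup>2"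
      using ne by (simp add: field_simps power2_eq_square)
    ultimately show ?thesis by simp
  qed
  have "(a\<^sup>2 + m * b\<^sup>2 + V) * (1 / a + m / b + V / (b\<^sup>2 * a) - d - 2 * s) + 2 * s * d
    = ((a\<^sup>2 + m * b\<^sup>2) * (1 / a + m / b - d - 2 * s) + 2 * s * d)
     + V * (1 / a + m / b - d - 2 * s + (a\<^sup>2 + m * b\<^sup>2) / (b\<^sup>2 * a)) + V\<^sup>2 / (b\<^sup>2 * a)"
    by (simp add: algebra_simps power2_eq_square add_divide_distrib)
  then show ?thesis unfolding c0 c1 .
qed


text \<open>With \<open>Q\<close> the sum of squares and \<open>T\<close> the sum of reciprocals,
  \<open>G = Q * (T - d - 2 * s) + 2 * s * d\<close>. Fixing the largest coordinate and bounding the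
  other reciprocals near their mean \<open>b\<close> bounds \<open>T\<close> below, and
  \<open>gap_identity\<close> turns the resulting bound for \<open>G\<close> into a sum of three
  nonnegative terms. If \<open>G = 0\<close> all three vanish, which leaves only two-valued
  \<open>y\<close>.\<close>

lemma pairwise_gap:
  fixes y :: "'i::finite \<Rightarrow> real" and s :: real
  assumes pos: "\<And>i. 0 < y i" and tot: "(\<Sum>i\<in>UNIV. y i) = real CARD('i)"
    and s: "s\<^sup>2 = real CARD('i) - 1" and two: "CARD('i) \<ge> 2"
  defines "G \<equiv> (\<Sum>i\<in>UNIV. \<Sum>j\<in>UNIV. (y j - y i)\<^sup>2 / y i)
      - (real CARD('i) + 2 * s) * (\<Sum>i\<in>UNIV. (y i - 1)\<^sup>2)"
  shows "0 \<le> G"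
    and "G = 0 \<Longrightarrow> \<exists>i a b. y i = a \<and> (\<forall>j. j \<noteq> i \<longrightarrow> y j = b) \<and> (a = b \<or> a = s * b)"
proof -
  define d where "d = real CARD('i)"
  define m where "m = d - 1"
  have d: "2 \<le> d" and m: "1 \<le> m" using two by (auto simp: d_def m_def)
  \<comment> \<open>The maximum serves twice: it replaces \<open>y j\<close> in the denominator of a
    Taylor remainder, and it gives \<open>b \<le> a\<close>, the sign needed in the coefficient of
    \<open>V\<close>.\<close>
  have "Max (range y) \<in> range y" by (intro Max_in) auto
  then obtain i where i: "y i = Max (range y)" by fastforce
  have ymax: "y j \<le> y i" for j unfolding i by (intro Max_ge) auto
  define a where "a = y i"
  define b where "b = (d - a) / m"
  define J where "J = UNIV - {i}"
  have cardJ: "real (card J) = m" using two by (simp add: J_def m_def d_def card_Diff_singleton of_nat_diff)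
  have split: "(\<Sum>j\<in>UNIV. f j) = f i + (\<Sum>j\<in>J. f j)" for f :: "'i \<Rightarrow> real"
    unfolding J_def by (simp add: sum.remove)
  have sumJ: "(\<Sum>j\<in>J. y j) = m * b"
    using tot split[of y] m by (simp add: a_def b_def d_def)
  have Jne: "J \<noteq> {}" using cardJ m by auto
  have "0 < (\<Sum>j\<in>J. y j)" using Jne pos by (intro sum_pos) (auto simp: J_def)
  then have b: "0 < b" using sumJ m by (simp add: zero_less_mult_iff)
  have a: "0 < a" unfolding a_def by (rule pos)
  have abd: "a + m * b = d" using m by (simp add: b_def)
  have "(\<Sum>j\<in>J. y j) \<le> (\<Sum>j\<in>J. a)" unfolding a_def by (intro sum_mono ymax)
  then have "m * b \<le> m * a" using sumJ cardJ by simp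
  then have ab: "b \<le> a" using m by simp
  define V where "V = (\<Sum>j\<in>J. (y j - b)\<^sup>2)"
  have V: "0 \<le> V" unfolding V_def by (intro sum_nonneg) auto
  define Q where "Q = (\<Sum>j\<in>UNIV. (y j)\<^sup>2)"
  define T where "T = (\<Sum>j\<in>UNIV. 1 / y j)"
  have Q: "Q = a\<^sup>2 + m * b\<^sup>2 + V"
  proof -
    have "V = (\<Sum>j\<in>J. (y j)\<^sup>2 - 2 * b * y j + b\<^sup>2)"
      unfolding V_def by (intro sum.cong refl) (simp add: power2_eq_square algebra_simps)
    also have "\<dots> = (\<Sum>j\<in>J. (y j)\<^sup>2) - 2 * b * (m * b) + m * b\<^sup>2"
      by (simp add: sum.distrib sum_subtractf sumJ cardJ flip: sum_distrib_left)
    finally show ?thesis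
      using split[of "\<lambda>j. (y j)\<^sup>2"] by (simp add: Q_def a_def power2_eq_square)
  qed
  have T: "1 / a + m / b + V / (b\<^sup>2 * a) \<le> T"
  proof -
    \<comment> \<open>Exact expansion of \<open>1 / y j\<close> at \<open>b\<close> with remainder
      \<open>(y j - b)\<^sup>2 / (b\<^sup>2 * y j)\<close>, where the denominator is then enlarged
      by \<open>y j \<le> a\<close>.\<close>
    have tangent: "1 / b - (y j - b) / b\<^sup>2 + (y j - b)\<^sup>2 / (b\<^sup>2 * a) \<le> 1 / y j" for j
    proof -
      have "1 / y j = 1 / b - (y j - b) / b\<^sup>2 + (y j - b)\<^sup>2 / (b\<^sup>2 * y j)"
        using b pos[of j] by (simp add: divide_simps) (simp add: algebra_simps power2_eq_square)
      moreover have "(y j - b)\<^sup>2 / (b\<^sup>2 * a) \<le> (y j - b)\<^sup>2 / (b\<^sup>2 * y j)"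
        using b pos[of j] ymax[of j] a by (intro divide_left_mono mult_left_mono) (auto simp: a_def)
      ultimately show ?thesis by linarith
    qed
    \<comment> \<open>The linear terms cancel because \<open>b\<close> is the mean over
      \<open>J\<close>, and the quadratic ones add up to \<open>V\<close>.\<close>
    have "1 / a + m / b + V / (b\<^sup>2 * a)
        = 1 / a + (\<Sum>j\<in>J. 1 / b - (y j - b) / b\<^sup>2 + (y j - b)\<^sup>2 / (b\<^sup>2 * a))"
      by (simp add: sum.distrib sum_subtractf sumJ cardJ V_def flip: sum_divide_distrib)
    also have "\<dots> \<le> 1 / a + (\<Sum>j\<in>J. 1 / y j)"
      using tangent by (intro add_left_mono sum_mono)
    also have "\<dots> = T" unfolding T_def split[of "\<lambda>j. 1 / y j"] a_def ..
    finally show ?thesis .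
  qed
  have "(\<Sum>i\<in>UNIV. (y i - 1)\<^sup>2) = (\<Sum>i\<in>UNIV. (y i)\<^sup>2 - 2 * y i + 1)"
    by (intro sum.cong refl) (simp add: power2_eq_square algebra_simps)
  also have "\<dots> = Q - d"
    by (simp add: sum.distrib sum_subtractf tot Q_def d_def flip: sum_distrib_left)
  finally have sq: "(\<Sum>i\<in>UNIV. (y i - 1)\<^sup>2) = Q - d" .
  have G: "G = Q * (T - d - 2 * s) + 2 * s * d"
    unfolding G_def pairwise_sum_expand[OF pos tot] sq
    unfolding Q_def[symmetric] T_def[symmetric] d_def[symmetric]
    by (simp add: algebra_simps power2_eq_square)
  have Q0: "0 < Q" unfolding Q using a b m V by (simp add: add_pos_nonneg)
  have "Q * (1 / a + m / b + V / (b\<^sup>2 * a) - d - 2 * s) + 2 * s * d \<le> G"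
    unfolding G using T Q0 by (intro add_right_mono mult_left_mono) auto
  moreover have "Q * (1 / a + m / b + V / (b\<^sup>2 * a) - d - 2 * s) + 2 * s * d =
      m * (a - b)\<^sup>2 * (a - s * b)\<^sup>2 / (d * a * b)
       + V * ((a - s * b)\<^sup>2 / (a * b) + (a - b) / b\<^sup>2) + V\<^sup>2 / (b\<^sup>2 * a)"
    unfolding Q using a b abd m_def s d by (intro gap_identity) (auto simp: d_def)
  ultimately have low: "m * (a - b)\<^sup>2 * (a - s * b)\<^sup>2 / (d * a * b)
       + V * ((a - s * b)\<^sup>2 / (a * b) + (a - b) / b\<^sup>2) + V\<^sup>2 / (b\<^sup>2 * a) \<le> G" by simp
  have n1: "0 \<le> m * (a - b)\<^sup>2 * (a - s * b)\<^sup>2 / (d * a * b)" using m a b d by simp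
  have n2: "0 \<le> V * ((a - s * b)\<^sup>2 / (a * b) + (a - b) / b\<^sup>2)" using V a b ab by simp
  have n3: "0 \<le> V\<^sup>2 / (b\<^sup>2 * a)" using a b by simp
  show "0 \<le> G" using low n1 n2 n3 by linarith
  assume "G = 0"
  then have z1: "m * (a - b)\<^sup>2 * (a - s * b)\<^sup>2 / (d * a * b) = 0" and z2: "V\<^sup>2 / (b\<^sup>2 * a) = 0"
    using low n1 n2 n3 by linarith+
  from z2 have "V = 0" using a b by simp
  then have "\<forall>j\<in>J. (y j - b)\<^sup>2 = 0"
    unfolding V_def by (subst (asm) sum_nonneg_eq_0_iff) auto
  then have "\<forall>j. j \<noteq> i \<longrightarrow> y j = b" by (auto simp: J_def)
  moreover have "a = b \<or> a = s * b" using z1 m a b d by simp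
  ultimately show "\<exists>i a b. y i = a \<and> (\<forall>j. j \<noteq> i \<longrightarrow> y j = b) \<and> (a = b \<or> a = s * b)"
    using a_def by metis
qed

subsection \<open>Sums of independent centred variables; labellings\<close>

text \<open>Writes a product of two single-coordinate factors as a product over all of
  \<open>I\<close>, the form in which integrals factor over a product measure; the two indices may
  coincide.\<close>

lemma prod_if_eq_two:
  fixes u :: "'a \<Rightarrow> real"
  assumes "finite I" "i \<in> I" "j \<in> I"
  shows "(\<Prod>k\<in>I. (if k = i then u k else 1) * (if k = j then v k else 1)) = u i * v j"
  using assms by (simp add: prod.distrib prod.delta)

text \<open>After expanding the square, each off-diagonal expectation factors and contains a
  vanishing mean, while the diagonal ones are the second moments.\<close>

lemma
  fixes f :: "'a \<Rightarrow> 'b \<Rightarrow> real"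
  assumes M: "\<And>i. prob_space (M i)" and I: "finite I"
    and f1: "\<And>i. i \<in> I \<Longrightarrow> integrable (M i) (f i)"
    and f2: "\<And>i. i \<in> I \<Longrightarrow> integrable (M i) (\<lambda>x. (f i x)\<^sup>2)"
    and f0: "\<And>i. i \<in> I \<Longrightarrow> (\<integral>x. f i x \<partial>M i) = 0"
  shows integrable_PiM_sum_square: "integrable (PiM I M) (\<lambda>x. (\<Sum>i\<in>I. f i (x i))\<^sup>2)"
    and integral_PiM_sum_square:
      "(\<integral>x. (\<Sum>i\<in>I. f i (x i))\<^sup>2 \<partial>PiM I M) = (\<Sum>i\<in>I. \<integral>x. (f i x)\<^sup>2 \<partial>M i)"
proof -
  interpret product_prob_space M I
    using M by (simp add: product_prob_space_def product_prob_space_axioms_def product_sigma_finite_def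
        prob_space_imp_sigma_finite)
  have pair: "integrable (PiM I M) (\<lambda>x. f i (x i) * f j (x j))
      \<and> (\<integral>x. f i (x i) * f j (x j) \<partial>PiM I M) = (if i = j then \<integral>x. (f i x)\<^sup>2 \<partial>M i else 0)"
    if ij: "i \<in> I" "j \<in> I" for i j
  proof -
    let ?g = "\<lambda>k x. (if k = i then f i x else 1) * (if k = j then f j x else 1)"
    have eq: "(\<Prod>k\<in>I. ?g k (x k)) = f i (x i) * f j (x j)" for x
      using prod_if_eq_two[OF I ij, of "\<lambda>k. f i (x k)" "\<lambda>k. f j (x k)"] by simp
    have int: "integrable (M k) (?g k)" if "k \<in> I" for k
      using f1[OF that] f2[OF that] M.integrable_const[of k 1]
      by (cases "k = i"; cases "k = j") (auto simp: power2_eq_square)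
    have "(\<Prod>k\<in>I. integral\<^sup>L (M k) (?g k)) = (if i = j then \<integral>x. (f i x)\<^sup>2 \<partial>M i else 0)"
    proof (cases "i = j")
      case True
      have "(\<Prod>k\<in>I. integral\<^sup>L (M k) (?g k)) = (\<Prod>k\<in>I. if k = i then \<integral>x. (f i x)\<^sup>2 \<partial>M i else 1)"
        using True by (intro prod.cong refl) (auto simp: power2_eq_square M.prob_space)
      then show ?thesis using True I ij by simp
    next
      case False
      then have "integral\<^sup>L (M i) (?g i) = 0" using f0[OF ij(1)] by simp
      then have "(\<Prod>k\<in>I. integral\<^sup>L (M k) (?g k)) = 0" using I ij(1) by (intro prod_zero bexI[of _ i])
      then show ?thesis using False by simp
    qed
    then show ?thesis
      using product_integrable_prod[OF I int] product_integral_prod[OF I int] unfolding eq by simp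
  qed
  have sq: "(\<Sum>i\<in>I. f i (x i))\<^sup>2 = (\<Sum>i\<in>I. \<Sum>j\<in>I. f i (x i) * f j (x j))" for x
    by (simp add: power2_eq_square sum_product)
  show "integrable (PiM I M) (\<lambda>x. (\<Sum>i\<in>I. f i (x i))\<^sup>2)"
    unfolding sq using pair by (intro Bochner_Integration.integrable_sum) auto
  have "(\<integral>x. (\<Sum>i\<in>I. f i (x i))\<^sup>2 \<partial>PiM I M) = (\<Sum>i\<in>I. \<Sum>j\<in>I. \<integral>x. f i (x i) * f j (x j) \<partial>PiM I M)"
    unfolding sq using pair
    by (subst Bochner_Integration.integral_sum) (auto intro!: Bochner_Integration.integrable_sum sum.cong)
  also have "\<dots> = (\<Sum>i\<in>I. \<Sum>j\<in>I. if i = j then \<integral>x. (f i x)\<^sup>2 \<partial>M i else 0)"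
    using pair by (intro sum.cong refl) auto
  also have "\<dots> = (\<Sum>i\<in>I. \<integral>x. (f i x)\<^sup>2 \<partial>M i)" using I by simp
  finally show "(\<integral>x. (\<Sum>i\<in>I. f i (x i))\<^sup>2 \<partial>PiM I M) = (\<Sum>i\<in>I. \<integral>x. (f i x)\<^sup>2 \<partial>M i)" .
qed

lemma norm_square_Basis: "(norm v)\<^sup>2 = (\<Sum>b\<in>Basis. (v \<bullet> b)\<^sup>2)"
  for v :: "'a::euclidean_space"
  unfolding power2_norm_eq_inner euclidean_inner[of v v] by (simp add: power2_eq_square)

text \<open>The scalar identity, applied to each coordinate of an orthonormal basis.\<close>

lemma integral_PiM_norm_sum_square:
  fixes f :: "'a \<Rightarrow> 'b \<Rightarrow> 'c::euclidean_space"
  assumes M: "\<And>i. prob_space (M i)" and I: "finite I"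
    and f1: "\<And>i. i \<in> I \<Longrightarrow> integrable (M i) (f i)"
    and f2: "\<And>i b. i \<in> I \<Longrightarrow> integrable (M i) (\<lambda>x. (f i x \<bullet> b)\<^sup>2)"
    and f0: "\<And>i. i \<in> I \<Longrightarrow> (\<integral>x. f i x \<partial>M i) = 0"
  shows "(\<integral>x. (norm (\<Sum>i\<in>I. f i (x i)))\<^sup>2 \<partial>PiM I M) = (\<Sum>i\<in>I. \<integral>x. (norm (f i x))\<^sup>2 \<partial>M i)"
proof -
  have z: "(\<integral>x. f i x \<bullet> b \<partial>M i) = 0" if "i \<in> I" for i b
    using f0[OF that] f1[OF that] by simp
  have i1: "integrable (M i) (\<lambda>x. f i x \<bullet> b)" if "i \<in> I" for i b
    using f1[OF that] by simp
  have "(\<integral>x. (norm (\<Sum>i\<in>I. f i (x i)))\<^sup>2 \<partial>PiM I M)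
      = (\<integral>x. (\<Sum>b\<in>Basis. (\<Sum>i\<in>I. f i (x i) \<bullet> b)\<^sup>2) \<partial>PiM I M)"
    by (simp add: norm_square_Basis inner_sum_left)
  also have "\<dots> = (\<Sum>b\<in>Basis. \<Sum>i\<in>I. \<integral>x. (f i x \<bullet> b)\<^sup>2 \<partial>M i)"
    using M I i1 f2 z
    by (subst Bochner_Integration.integral_sum)
       (auto intro!: integrable_PiM_sum_square integral_PiM_sum_square sum.cong)
  also have "\<dots> = (\<Sum>i\<in>I. \<integral>x. (norm (f i x))\<^sup>2 \<partial>M i)"
    by (subst sum.swap) (simp add: norm_square_Basis f2 Bochner_Integration.integral_sum)
  finally show ?thesis .
qed

section \<open>Labellings with prescribed composition\<close>

lemma exists_labelling:
  fixes k :: "'i::finite \<Rightarrow> nat"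
  assumes "(\<Sum>i\<in>UNIV. k i) = n"
  shows "\<exists>c. \<forall>i. card {m\<in>{..<n}. c m = i} = k i"
  using assms
proof (induction n arbitrary: k)
  case 0
  then show ?case by simp
next
  case (Suc n)
  \<comment> \<open>The counts sum to \<open>Suc n\<close>, so some label has a positive count; it
    is given to the new slot \<open>n\<close>, and its count drops by one for the induction
    hypothesis.\<close>
  then obtain i where i: "k i > 0" by (metis neq0_conv sum.neutral zero_less_Suc nat.simps(3))
  have "(\<Sum>j\<in>UNIV. k j) = k i + (\<Sum>j\<in>UNIV - {i}. k j)" by (simp add: sum.remove)
  moreover have "(\<Sum>j\<in>UNIV. (k(i := k i - 1)) j) = (k i - 1) + (\<Sum>j\<in>UNIV - {i}. k j)"
    by (simp add: sum.remove[of _ i])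
  ultimately have "(\<Sum>j\<in>UNIV. (k(i := k i - 1)) j) = n" using Suc.prems i by simp
  from Suc.IH[OF this] obtain c where c: "\<And>j. card {m\<in>{..<n}. c m = j} = (k(i := k i - 1)) j" by blast
  have "card {m\<in>{..<Suc n}. (c(n := i)) m = j} = k j" for j
  proof -
    have "{m\<in>{..<Suc n}. (c(n := i)) m = j} = {m\<in>{..<n}. c m = j} \<union> (if j = i then {n} else {})"
      by (auto simp: less_Suc_eq)
    then show ?thesis using c[of j] i by (auto simp: card_Un_disjoint)
  qed
  then show ?case by blast
qed

text \<open>Justifies the choice made in \<open>labelling\<close>: the prescribed counts are
  naturals with sum \<open>n\<close>, so a labelling of this kind exists.\<close>

lemma labelling_count:
  assumes "\<theta> \<in> fc_simplex n"
  shows "real (card {m\<in>{..<n}. labelling n \<theta> m = i}) = real n * \<theta> $ i"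
proof -
  have th: "\<theta> \<in> prob_simplex" and int: "real n * \<theta> $ j \<in> \<int>" for j
    using assms by (auto simp: fc_simplex_def)
  \<comment> \<open>By hypothesis the rounded number is already a nonnegative integer, so nothing is
    lost.\<close>
  define k where "k j = nat \<lfloor>real n * \<theta> $ j\<rfloor>" for j
  have k: "real (k j) = real n * \<theta> $ j" for j
    using int[of j] th by (auto simp: k_def prob_simplex_def elim!: Ints_cases)
  have "real (\<Sum>j\<in>UNIV. k j) = real n * (\<Sum>j\<in>UNIV. \<theta> $ j)"
    by (simp add: k sum_distrib_left)
  then have "(\<Sum>j\<in>UNIV. k j) = n" using th
    unfolding prob_simplex_def mem_Collect_eq by (metis mult.right_neutral of_nat_eq_iff)
  from exists_labelling[OF this] obtain c where "\<forall>i. card {m\<in>{..<n}. c m = i} = k i" by blast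
  then have "\<exists>c. \<forall>i. real (card {m\<in>{..<n}. c m = i}) = real n * \<theta> $ i" using k by metis
  then show ?thesis unfolding labelling_def by (rule someI2_ex) blast
qed

text \<open>Grouping the slots by label leaves only the composition, so such sums do not depend on
  which labelling was chosen.\<close>

lemma sum_labelling:
  fixes g :: "'i::finite \<Rightarrow> 'a::real_vector"
  assumes "\<theta> \<in> fc_simplex n"
  shows "(\<Sum>m<n. g (labelling n \<theta> m)) = real n *\<^sub>R (\<Sum>i\<in>UNIV. \<theta> $ i *\<^sub>R g i)"
proof -
  have "(\<Sum>m<n. g (labelling n \<theta> m))
      = (\<Sum>i\<in>UNIV. \<Sum>m\<in>{m\<in>{..<n}. labelling n \<theta> m = i}. g (labelling n \<theta> m))"
    by (rule sum.group[symmetric]) auto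
  also have "\<dots> = (\<Sum>i\<in>UNIV. real (card {m\<in>{..<n}. labelling n \<theta> m = i}) *\<^sub>R g i)"
    by (intro sum.cong refl) (simp add: sum_constant_scaleR)
  also have "\<dots> = real n *\<^sub>R (\<Sum>i\<in>UNIV. \<theta> $ i *\<^sub>R g i)"
    unfolding labelling_count[OF assms] by (simp add: scaleR_sum_right)
  finally show ?thesis .
qed

text \<open>Vertices are admissible compositions for every \<open>n\<close>, whereas the barycentre
  is not in general; this is why the fixed-composition lower bound works with vertices.\<close>

lemma axis_in_fc_simplex: "axis i 1 \<in> fc_simplex n"
  using axis_in_prob_simplex by (auto simp: fc_simplex_def axis_def)

subsection \<open>Risk of the canonical estimator\<close>

text \<open>Each coordinate \<open>u\<close> of \<open>H *v x\<close> is at least -1, so its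
  absolute value is at most \<open>2 + u\<close>, and the coordinates sum to zero. Boundedness of
  \<open>Xd H\<close> makes continuous functions integrable under anchored laws.\<close>

lemma norm_Xd_le:
  fixes H :: "real^'k^'i"
  assumes "valid_H H" "x \<in> Xd H"
  shows "norm x \<le> 2 * real CARD('i)"
proof -
  have "norm x = norm (H *v x)" by (simp add: norm_mult_H[OF assms(1)])
  also have "\<dots> \<le> (\<Sum>i\<in>UNIV. \<bar>(H *v x) $ i\<bar>)" by (rule norm_le_l1_cart)
  also have "\<dots> \<le> (\<Sum>i\<in>UNIV. 2 + gam H i \<bullet> x)"
  proof (rule sum_mono)
    fix i show "\<bar>(H *v x) $ i\<bar> \<le> 2 + gam H i \<bullet> x"
      using assms(2) by (auto simp: matrix_vector_nth_gam Xd_def abs_if dest!: spec[of _ i])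
  qed
  also have "\<dots> = 2 * real CARD('i)"
    by (simp add: sum.distrib sum_gam_inner[OF assms(1)])
  finally show ?thesis .
qed

lemma matrix_inv_mult:
  fixes A :: "real^'n^'n"
  assumes "invertible A"
  shows "matrix_inv A ** A = mat 1" "A ** matrix_inv A = mat 1"
  using assms unfolding invertible_def matrix_inv_def by (rule someI2_ex, blast)+

text \<open>The common form of both sampling laws: at \<theta> it is the law of one i.i.d.
  observation, and at a vertex of the simplex it is the corresponding \<open>Wlaw\<close>.\<close>

definition tilt :: "real^'k^'i \<Rightarrow> (real^'k) measure \<Rightarrow> real^'i \<Rightarrow> (real^'k) measure" where
  "tilt H \<rho> \<theta> = density \<rho> (\<lambda>x. ennreal (1 + hvec H \<theta> \<bullet> x))"

text \<open>The uncentred second moment of the one-observation estimate under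
  \<open>tilt H \<rho> \<theta>\<close>, written over \<rho> so that its affine dependence on
  \<theta> is visible.\<close>

definition J_risk :: "real^'k^'i \<Rightarrow> (real^'k) measure \<Rightarrow> real^'i \<Rightarrow> real" where
  "J_risk H \<rho> \<theta> = (\<integral>x. (1 + hvec H \<theta> \<bullet> x) * (norm (matrix_inv (Sigma_mat \<rho>) *v x))\<^sup>2 \<partial>\<rho>)"

locale anchored_law =
  fixes H :: "real^'k^'i" and \<rho> :: "(real^'k) measure"
  assumes valid: "valid_H H" and law: "\<rho> \<in> anchored H"
begin

sublocale prob_space \<rho> using law by (simp add: anchored_def)

lemma sets_law: "sets \<rho> = sets borel" using law by (simp add: anchored_def)

lemma measurable_law: "f \<in> borel_measurable borel \<Longrightarrow> f \<in> borel_measurable \<rho>"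
  using measurable_cong_sets[OF sets_law refl] by blast

lemma AE_Xd: "AE x in \<rho>. x \<in> Xd H"
proof -
  have "- Xd H \<in> sets \<rho>" using closed_Xd[of H] unfolding sets_law by auto
  then show ?thesis using law by (intro AE_I[where N = "- Xd H"]) (auto simp: anchored_def)
qed

text \<open>The law is carried by a bounded set, on which a continuous function is bounded by
  compactness of a ball.\<close>

lemma integrable_continuous:
  fixes f :: "real^'k \<Rightarrow> 'b::{banach, second_countable_topology}"
  assumes "continuous_on UNIV f"
  shows "integrable \<rho> f"
proof -
  have "compact (f ` cball 0 (2 * real CARD('i)))"
    using assms by (intro compact_continuous_image continuous_on_subset[OF assms]) auto
  then obtain B where B: "\<And>x. norm x \<le> 2 * real CARD('i) \<Longrightarrow> norm (f x) \<le> B"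
    by (force dest: compact_imp_bounded simp: bounded_iff)
  have "AE x in \<rho>. norm (f x) \<le> B"
    using AE_Xd by eventually_elim (intro B norm_Xd_le[OF valid])
  moreover have "f \<in> borel_measurable \<rho>"
    using assms by (intro measurable_law borel_measurable_continuous_onI)
  ultimately show ?thesis by (rule integrable_const_bound)
qed

lemma mean_zero: "(\<integral>x. x \<partial>\<rho>) = 0" using law by (simp add: anchored_def)

lemma mean_inner_zero: "(\<integral>x. v \<bullet> x \<partial>\<rho>) = 0"
  using integral_inner_right[of v \<rho> "\<lambda>x. x"] mean_zero integrable_continuous[of "\<lambda>x. x"] by simp

lemma AE_tilt_nonneg: "\<theta> \<in> prob_simplex \<Longrightarrow> AE x in \<rho>. 0 \<le> 1 + hvec H \<theta> \<bullet> x"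
  using AE_Xd by eventually_elim (rule hvec_tilt_nonneg)

lemma tilt_measurable: "(\<lambda>x. 1 + hvec H \<theta> \<bullet> x) \<in> borel_measurable \<rho>"
  by (intro measurable_law borel_measurable_continuous_onI continuous_intros)

lemma integral_tilt:
  fixes f :: "real^'k \<Rightarrow> 'b::{banach, second_countable_topology}"
  assumes "\<theta> \<in> prob_simplex" "continuous_on UNIV f"
  shows "(\<integral>x. f x \<partial>tilt H \<rho> \<theta>) = (\<integral>x. (1 + hvec H \<theta> \<bullet> x) *\<^sub>R f x \<partial>\<rho>)"
  unfolding tilt_def using assms AE_tilt_nonneg tilt_measurable
  by (intro integral_density) (auto intro: measurable_law borel_measurable_continuous_onI)

lemma integrable_tilt:
  fixes f :: "real^'k \<Rightarrow> 'b::{banach, second_countable_topology}"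
  assumes "\<theta> \<in> prob_simplex" "continuous_on UNIV f"
  shows "integrable (tilt H \<rho> \<theta>) f"
proof -
  have "integrable \<rho> (\<lambda>x. (1 + hvec H \<theta> \<bullet> x) *\<^sub>R f x)"
    using assms(2) by (intro integrable_continuous continuous_intros)
  then show ?thesis unfolding tilt_def using assms AE_tilt_nonneg tilt_measurable
    by (subst integrable_density) (auto intro!: measurable_law borel_measurable_continuous_onI)
qed

lemma prob_space_tilt:
  assumes "\<theta> \<in> prob_simplex"
  shows "prob_space (tilt H \<rho> \<theta>)"
proof
  have "emeasure (tilt H \<rho> \<theta>) (space (tilt H \<rho> \<theta>)) = (\<integral>\<^sup>+x. ennreal (1 + hvec H \<theta> \<bullet> x) \<partial>\<rho>)"
    unfolding tilt_def using tilt_measurable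
    by (simp add: emeasure_density cong: nn_integral_cong_simp)
  also have "\<dots> = ennreal (\<integral>x. 1 + hvec H \<theta> \<bullet> x \<partial>\<rho>)"
    using AE_tilt_nonneg[OF assms]
    by (intro nn_integral_eq_integral integrable_continuous continuous_intros)
  also have "(\<integral>x. 1 + hvec H \<theta> \<bullet> x \<partial>\<rho>) = 1"
    by (subst Bochner_Integration.integral_add)
       (auto intro!: integrable_continuous continuous_intros simp: mean_inner_zero prob_space)
  finally show "emeasure (tilt H \<rho> \<theta>) (space (tilt H \<rho> \<theta>)) = 1" by simp
qed

lemma Sigma_mat_mult: "Sigma_mat \<rho> *v v = (\<integral>x. (v \<bullet> x) *\<^sub>R x \<partial>\<rho>)"
proof -
  have "(Sigma_mat \<rho> *v v) $ a = (\<integral>x. (v \<bullet> x) *\<^sub>R x \<partial>\<rho>) $ a" for a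
  proof -
    have "(\<integral>x. (v \<bullet> x) *\<^sub>R x \<partial>\<rho>) $ a = (\<integral>x. ((v \<bullet> x) *\<^sub>R x) $ a \<partial>\<rho>)"
      by (intro integral_bounded_linear[symmetric] bounded_linear_vec_nth integrable_continuous continuous_intros)
    also have "\<dots> = (\<integral>x. (\<Sum>b\<in>UNIV. v $ b * (x $ a * x $ b)) \<partial>\<rho>)"
      by (simp add: inner_vec_def sum_distrib_right sum_distrib_left ac_simps)
    also have "\<dots> = (\<Sum>b\<in>UNIV. v $ b * (\<integral>x. x $ a * x $ b \<partial>\<rho>))"
      by (subst Bochner_Integration.integral_sum)
         (auto intro!: integrable_continuous continuous_intros)
    finally show ?thesis by (simp add: Sigma_mat_def matrix_vector_mult_def ac_simps)
  qed
  then show ?thesis by (simp add: vec_eq_iff)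
qed

lemma continuous_matrix_vector: "continuous_on UNIV (\<lambda>x::real^'n. A *v x)"
  by (intro linear_continuous_on matrix_vector_mul_bounded_linear)

context
  assumes inv: "invertible (Sigma_mat \<rho>)"
begin

abbreviation "A \<equiv> matrix_inv (Sigma_mat \<rho>)"

text \<open>The constant part of the tilt contributes the zero mean of \<rho>, the linear part
  contributes \<Sigma> applied to \<open>hvec H \<theta>\<close>, and \<open>A\<close> undoes
  \<Sigma>.\<close>

lemma unbiased:
  assumes "\<theta> \<in> prob_simplex"
  shows "(\<integral>x. A *v x \<partial>tilt H \<rho> \<theta>) = hvec H \<theta>"
proof -
  have "(\<integral>x. A *v x \<partial>tilt H \<rho> \<theta>) = A *v (\<integral>x. x \<partial>tilt H \<rho> \<theta>)"
    using assms by (intro integral_bounded_linear matrix_vector_mul_bounded_linear integrable_tilt continuous_intros)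
  also have "(\<integral>x. x \<partial>tilt H \<rho> \<theta>) = (\<integral>x. (1 + hvec H \<theta> \<bullet> x) *\<^sub>R x \<partial>\<rho>)"
    using assms by (intro integral_tilt continuous_intros)
  also have "\<dots> = (\<integral>x. x + (hvec H \<theta> \<bullet> x) *\<^sub>R x \<partial>\<rho>)" by (simp add: algebra_simps)
  also have "\<dots> = Sigma_mat \<rho> *v hvec H \<theta>"
    by (subst Bochner_Integration.integral_add)
       (auto intro!: integrable_continuous continuous_intros simp: mean_zero Sigma_mat_mult)
  finally show ?thesis by (simp add: matrix_vector_mul_assoc matrix_inv_mult[OF inv])
qed

lemma variance_tilt:
  assumes "\<theta> \<in> prob_simplex"
  shows "(\<integral>x. (norm (A *v x - hvec H \<theta>))\<^sup>2 \<partial>tilt H \<rho> \<theta>) = J_risk H \<rho> \<theta> - (norm (hvec H \<theta>))\<^sup>2"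
proof -
  interpret T: prob_space "tilt H \<rho> \<theta>" using assms by (rule prob_space_tilt)
  note [continuous_intros] = continuous_matrix_vector
  have i: "integrable (tilt H \<rho> \<theta>) (\<lambda>x. A *v x)"
    using assms by (intro integrable_tilt continuous_intros)
  have i2: "integrable (tilt H \<rho> \<theta>) (\<lambda>x. (norm (A *v x))\<^sup>2)"
    using assms by (intro integrable_tilt continuous_intros)
  have "(\<integral>x. (norm (A *v x - hvec H \<theta>))\<^sup>2 \<partial>tilt H \<rho> \<theta>)
      = (\<integral>x. (norm (A *v x))\<^sup>2 - 2 * ((A *v x) \<bullet> hvec H \<theta>) + (norm (hvec H \<theta>))\<^sup>2 \<partial>tilt H \<rho> \<theta>)"
    by (simp add: power2_norm_eq_inner inner_diff_left inner_diff_right inner_commute algebra_simps)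
  also have "\<dots> = (\<integral>x. (norm (A *v x))\<^sup>2 \<partial>tilt H \<rho> \<theta>) - (norm (hvec H \<theta>))\<^sup>2"
    using i i2 by (simp add: T.prob_space unbiased[OF assms] power2_norm_eq_inner)
  also have "(\<integral>x. (norm (A *v x))\<^sup>2 \<partial>tilt H \<rho> \<theta>) = J_risk H \<rho> \<theta>"
    using assms unfolding J_risk_def by (subst integral_tilt) (auto intro!: continuous_intros)
  finally show ?thesis .
qed

text \<open>Each slot may have its own tilt, so both designs are covered at once; unbiasedness only
  requires the slot means to average to \<open>hvec H \<theta>\<close>.\<close>

lemma risk_PiM_tilt:
  assumes \<theta>: "(\<Sum>i\<in>UNIV. \<theta> $ i) = 1" and n: "1 \<le> n" and \<tau>: "\<And>m. \<tau> m \<in> prob_simplex"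
    and mean: "(\<Sum>m<n. hvec H (\<tau> m)) = real n *\<^sub>R hvec H \<theta>"
  shows "(\<integral>X. (norm (est H \<rho> n X - \<theta>))\<^sup>2 \<partial>PiM {..<n} (\<lambda>m. tilt H \<rho> (\<tau> m)))
     = (\<Sum>m<n. J_risk H \<rho> (\<tau> m) - (norm (hvec H (\<tau> m)))\<^sup>2) / (real n)\<^sup>2"
proof -
  note [continuous_intros] = continuous_matrix_vector
  have err: "norm (est H \<rho> n X - \<theta>) = norm (\<Sum>m<n. A *v X m - hvec H (\<tau> m)) / real n" for X
  proof -
    \<comment> \<open>\<open>H\<close> carries \<open>hvec H \<theta>\<close> to the centred
      \<theta>, so the constant shift in \<open>est\<close> cancels; being an isometry,
      \<open>H\<close> then drops out of the norm.\<close>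
    have "est H \<rho> n X - \<theta> = H *v (A *v ((1 / real n) *\<^sub>R (\<Sum>m<n. X m)) - hvec H \<theta>)"
      by (simp add: est_def matrix_vector_mult_diff_distrib mult_H_hvec[OF valid \<theta>])
    also have "A *v ((1 / real n) *\<^sub>R (\<Sum>m<n. X m)) - hvec H \<theta>
        = (1 / real n) *\<^sub>R (\<Sum>m<n. A *v X m - hvec H (\<tau> m))"
      using n by (simp add: sum_subtractf mean scaleR_diff_right linear_scale linear_sum
          matrix_vector_mul_linear)
    finally show ?thesis by (simp add: norm_mult_H[OF valid])
  qed
  have "(\<integral>X. (norm (est H \<rho> n X - \<theta>))\<^sup>2 \<partial>PiM {..<n} (\<lambda>m. tilt H \<rho> (\<tau> m)))
      = (\<integral>X. (norm (\<Sum>m<n. A *v X m - hvec H (\<tau> m)))\<^sup>2 \<partial>PiM {..<n} (\<lambda>m. tilt H \<rho> (\<tau> m))) / (real n)\<^sup>2"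
    by (simp add: err power_divide)
  also have "(\<integral>X. (norm (\<Sum>m<n. A *v X m - hvec H (\<tau> m)))\<^sup>2 \<partial>PiM {..<n} (\<lambda>m. tilt H \<rho> (\<tau> m)))
      = (\<Sum>m<n. \<integral>x. (norm (A *v x - hvec H (\<tau> m)))\<^sup>2 \<partial>tilt H \<rho> (\<tau> m))"
  proof (rule integral_PiM_norm_sum_square)
    fix m
    show ps: "prob_space (tilt H \<rho> (\<tau> m))" by (intro prob_space_tilt \<tau>)
    interpret T: prob_space "tilt H \<rho> (\<tau> m)" by (rule ps)
    show "integrable (tilt H \<rho> (\<tau> m)) (\<lambda>x. A *v x - hvec H (\<tau> m))"
      by (intro integrable_tilt \<tau> continuous_intros)
    show "integrable (tilt H \<rho> (\<tau> m)) (\<lambda>x. ((A *v x - hvec H (\<tau> m)) \<bullet> b)\<^sup>2)" for b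
      by (intro integrable_tilt \<tau> continuous_intros)
    have "integrable (tilt H \<rho> (\<tau> m)) (\<lambda>x. A *v x)"
      by (intro integrable_tilt \<tau> continuous_intros)
    then show "(\<integral>x. A *v x - hvec H (\<tau> m) \<partial>tilt H \<rho> (\<tau> m)) = 0"
      by (simp add: unbiased[OF \<tau>] T.prob_space)
  qed simp
  finally show ?thesis by (simp add: variance_tilt \<tau>)
qed

lemma R_iid_eq:
  assumes "\<theta> \<in> prob_simplex" "1 \<le> n"
  shows "R_iid H n \<theta> \<rho> = ereal ((J_risk H \<rho> \<theta> - (norm (hvec H \<theta>))\<^sup>2) / real n)"
proof -
  have "(\<integral>X. (norm (est H \<rho> n X - \<theta>))\<^sup>2 \<partial>PiM {..<n} (\<lambda>m. tilt H \<rho> \<theta>))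
      = (\<Sum>m<n. J_risk H \<rho> \<theta> - (norm (hvec H \<theta>))\<^sup>2) / (real n)\<^sup>2"
    using assms by (intro risk_PiM_tilt) (auto simp: prob_simplex_def sum_constant_scaleR simp del: sum_constant)
  then show ?thesis using inv assms(2)
    by (simp add: R_iid_def tilt_def[symmetric] power2_eq_square)
qed

text \<open>All slots are tilted by vertices, and every \<open>gam H i\<close> has squared norm
  \<open>1 - 1 / d\<close>, so the subtracted term no longer depends on \<theta>. Since
  \<open>J_risk\<close> is affine in \<theta>, its average over the slots is its value at
  \<theta>.\<close>

lemma R_fc_eq:
  assumes \<theta>: "\<theta> \<in> fc_simplex n" and n: "1 \<le> n"
  shows "R_fc H n \<theta> \<rho> = ereal ((J_risk H \<rho> \<theta> - (1 - 1 / real CARD('i))) / real n)"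
proof -
  note [continuous_intros] = continuous_matrix_vector
  have tot: "(\<Sum>i\<in>UNIV. \<theta> $ i) = 1"
    using \<theta> by (auto simp: fc_simplex_def prob_simplex_def)
  let ?\<tau> = "\<lambda>m. axis (labelling n \<theta> m) 1 :: real^'i"
  have W: "Wlaw H \<rho> i = tilt H \<rho> (axis i 1)" for i
    by (simp add: Wlaw_def tilt_def hvec_axis[OF valid])
  have J: "(\<Sum>i\<in>UNIV. \<theta> $ i *\<^sub>R J_risk H \<rho> (axis i 1)) = J_risk H \<rho> \<theta>"
  proof -
    have "J_risk H \<rho> \<theta> = (\<integral>x. (\<Sum>i\<in>UNIV. \<theta> $ i * ((1 + gam H i \<bullet> x) * (norm (A *v x))\<^sup>2)) \<partial>\<rho>)"
      unfolding J_risk_def using tot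
      by (intro Bochner_Integration.integral_cong refl)
         (simp add: hvec_inner distrib_right distrib_left sum.distrib sum_distrib_right mult.assoc
           flip: sum_distrib_right[of _ _ "(norm _)\<^sup>2"])
    also have "\<dots> = (\<Sum>i\<in>UNIV. \<theta> $ i *\<^sub>R J_risk H \<rho> (axis i 1))"
      by (subst Bochner_Integration.integral_sum)
         (auto intro!: integrable_continuous continuous_intros simp: J_risk_def hvec_axis[OF valid])
    finally show ?thesis by simp
  qed
  have "(\<integral>X. (norm (est H \<rho> n X - \<theta>))\<^sup>2 \<partial>PiM {..<n} (\<lambda>m. tilt H \<rho> (?\<tau> m)))
      = (\<Sum>m<n. J_risk H \<rho> (?\<tau> m) - (norm (hvec H (?\<tau> m)))\<^sup>2) / (real n)\<^sup>2"
    using tot n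
  proof (rule risk_PiM_tilt)
    show "(\<Sum>m<n. hvec H (?\<tau> m)) = real n *\<^sub>R hvec H \<theta>"
      using sum_labelling[OF \<theta>, of "gam H"] unfolding hvec_axis[OF valid] unfolding hvec_def .
  qed (rule axis_in_prob_simplex)
  also have "(\<Sum>m<n. J_risk H \<rho> (?\<tau> m) - (norm (hvec H (?\<tau> m)))\<^sup>2)
      = (\<Sum>m<n. J_risk H \<rho> (?\<tau> m)) - real n * (1 - 1 / real CARD('i))"
    by (simp add: sum_subtractf hvec_axis[OF valid] power2_norm_eq_inner inner_gam[OF valid])
  also have "(\<Sum>m<n. J_risk H \<rho> (?\<tau> m)) = real n * J_risk H \<rho> \<theta>"
    using sum_labelling[OF \<theta>, of "\<lambda>i. J_risk H \<rho> (axis i 1)"] J by simp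
  finally show ?thesis using inv n
    by (simp add: R_fc_def W power2_eq_square flip: right_diff_distrib)
qed

section \<open>Trace of the inverse second-moment matrix\<close>

lemma trace_identity: "(\<integral>x. x \<bullet> (A *v x) \<partial>\<rho>) = real CARD('k)"
proof -
  have "(\<integral>x. x \<bullet> (A *v x) \<partial>\<rho>) = (\<integral>x. (\<Sum>a\<in>UNIV. \<Sum>b\<in>UNIV. A $ a $ b * (x $ b * x $ a)) \<partial>\<rho>)"
    by (simp add: inner_vec_def matrix_vector_mult_def sum_distrib_left ac_simps)
  also have "\<dots> = (\<Sum>a\<in>UNIV. \<Sum>b\<in>UNIV. A $ a $ b * (\<integral>x. x $ b * x $ a \<partial>\<rho>))"
    by (simp add: Bochner_Integration.integral_sum integrable_continuous continuous_intros)
  also have "\<dots> = (\<Sum>a\<in>UNIV. (A ** Sigma_mat \<rho>) $ a $ a)"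
    by (simp add: matrix_matrix_mult_def Sigma_mat_def)
  also have "\<dots> = real CARD('k)" by (simp add: matrix_inv_mult[OF inv] mat_def)
  finally show ?thesis .
qed

text \<open>The right-hand side is the trace of \<open>A\<close>. The bound comes from the
  nonnegative integral of the squared norm of \<open>A *v x - c *\<^sub>R x\<close>, whose cross
  term is known from \<open>trace_identity\<close>.\<close>

lemma trace_inverse_lower:
  assumes "0 < K" "(\<integral>x. (norm x)\<^sup>2 \<partial>\<rho>) \<le> K"
  shows "(real CARD('k))\<^sup>2 / K \<le> (\<integral>x. (norm (A *v x))\<^sup>2 \<partial>\<rho>)"
proof -
  note [continuous_intros] = continuous_matrix_vector
  \<comment> \<open>This \<open>c\<close> maximizes the resulting lower bound
    \<open>2 * c * k - c\<^sup>2 * K\<close>, where \<open>k = CARD('k)\<close>.\<close>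
  define c where "c = real CARD('k) / K"
  have i: "integrable \<rho> (\<lambda>x. (norm (A *v x))\<^sup>2)" "integrable \<rho> (\<lambda>x. x \<bullet> (A *v x))"
      "integrable \<rho> (\<lambda>x. (norm x)\<^sup>2)"
    by (intro integrable_continuous continuous_intros)+
  have "0 \<le> (\<integral>x. (norm (A *v x - c *\<^sub>R x))\<^sup>2 \<partial>\<rho>)" by (intro integral_nonneg_AE) auto
  also have "\<dots> = (\<integral>x. (norm (A *v x))\<^sup>2 - 2 * c * (x \<bullet> (A *v x)) + c\<^sup>2 * (norm x)\<^sup>2 \<partial>\<rho>)"
    unfolding power2_norm_eq_inner power2_eq_square[of c]
    by (simp add: inner_diff_left inner_diff_right inner_commute algebra_simps)
  also have "\<dots> = (\<integral>x. (norm (A *v x))\<^sup>2 \<partial>\<rho>) - 2 * c * real CARD('k) + c\<^sup>2 * (\<integral>x. (norm x)\<^sup>2 \<partial>\<rho>)"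
    using i by (simp add: trace_identity)
  also have "\<dots> \<le> (\<integral>x. (norm (A *v x))\<^sup>2 \<partial>\<rho>) - 2 * c * real CARD('k) + c\<^sup>2 * K"
    using assms(2) by (intro add_left_mono mult_left_mono) auto
  finally show ?thesis using assms(1) by (simp add: c_def power2_eq_square field_simps)
qed

end

end

subsection \<open>The budget constraint\<close>

lemma integral_finite_support:
  fixes f :: "'a::t1_space \<Rightarrow> 'b::{banach, second_countable_topology}"
  assumes "finite_measure M" and sets: "sets M = sets borel" and S: "finite S"
    and AE: "AE x in M. x \<in> S" and f: "f \<in> borel_measurable borel"
  shows integrable_finite_support: "integrable M f"
    and "(\<integral>x. f x \<partial>M) = (\<Sum>z\<in>S. measure M {z} *\<^sub>R f z)"
proof -
  interpret finite_measure M by fact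
  let ?g = "\<lambda>x. \<Sum>z\<in>S. indicat_real {z} x *\<^sub>R f z"
  have fM: "f \<in> borel_measurable M" using f measurable_cong_sets[OF sets refl] by blast
  have z: "{z} \<in> sets M" for z unfolding sets by simp
  have int: "integrable M (\<lambda>x. indicat_real {z} x *\<^sub>R f z)" for z
    using z by (intro integrable_scaleR_left integrable_real_indicator) (auto simp: emeasure_eq_measure)
  have gM: "integrable M ?g" using int by (intro Bochner_Integration.integrable_sum)
  have eq: "AE x in M. f x = ?g x"
    using AE
  proof eventually_elim
    case (elim x)
    have "?g x = (\<Sum>z\<in>S. if z = x then f z else 0)"
      by (intro sum.cong refl) (auto simp: indicator_def)
    then show ?case using S elim by simp
  qed
  show "integrable M f"
    using integrable_cong_AE[OF fM borel_measurable_integrable[OF gM] eq] gM by simp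
  have "(\<integral>x. f x \<partial>M) = (\<integral>x. ?g x \<partial>M)"
    using fM gM eq by (intro integral_cong_AE) auto
  also have "\<dots> = (\<Sum>z\<in>S. measure M {z} *\<^sub>R f z)"
    using int z by (subst Bochner_Integration.integral_sum)
      (auto intro!: sum.cong simp: emeasure_eq_measure sets.Int_space_eq2)
  finally show "(\<integral>x. f x \<partial>M) = (\<Sum>z\<in>S. measure M {z} *\<^sub>R f z)" .
qed

text \<open>With \<open>s = lam_star d\<close> one has \<open>d = s\<^sup>2 + 1\<close>, so both
  sides of the last identity equal \<open>s * (s + 1)\<^sup>2\<close>. It links the formula for
  \<open>C_star\<close> to the constant \<open>d + 2 * s\<close> of the pointwise
  inequality.\<close>

lemma lam_star_facts:
  assumes "3 \<le> d"
  shows "(lam_star d)\<^sup>2 = real d - 1" "1 < lam_star d"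
    "(lam_star d + 1) * (real d + lam_star d - 1) = lam_star d * (real d + 2 * lam_star d)"
proof -
  show sq: "(lam_star d)\<^sup>2 = real d - 1" using assms by (simp add: lam_star_def)
  show "1 < lam_star d" using assms by (simp add: lam_star_def real_less_rsqrt)
  have "real d = (lam_star d)\<^sup>2 + 1" using sq by simp
  then show "(lam_star d + 1) * (real d + lam_star d - 1) = lam_star d * (real d + 2 * lam_star d)"
    by algebra
qed

text \<open>At the point \<open>t *\<^sub>R gam H i\<close> the numbers
  \<open>1 + gam H j \<bullet> x\<close> are \<open>1 + t - t / d\<close> for \<open>j = i\<close>
  and \<open>1 - t / d\<close> otherwise; \<open>t\<close> is the scale at which their ratio is
  \<open>s\<close>, the equality case of \<open>pairwise_gap\<close>.\<close>

lemma t_lam_facts: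
  assumes "3 \<le> d"
  defines "s \<equiv> lam_star d" and "t \<equiv> t_lam d (lam_star d)"
  shows "0 < t" "1 - t / real d = real d / (real d + s - 1)"
    "1 + t - t / real d = s * (1 - t / real d)"
    "t\<^sup>2 * (real d + 2 * s) = (real d)\<^sup>2 * C_star d" "0 < C_star d"
proof -
  have d: "3 \<le> real d" using assms(1) by simp
  note s = lam_star_facts[OF assms(1), folded s_def]
  have t: "t = real d * (s - 1) / (real d + s - 1)" by (simp add: t_def t_lam_def s_def)
  have pos: "0 < real d + s - 1" using d s by simp
  show "0 < t" unfolding t using d s(2) by simp
  have "t / real d = (s - 1) / (real d + s - 1)" unfolding t using d by simp
  then show c: "1 - t / real d = real d / (real d + s - 1)"
    using pos by (simp add: field_simps)
  have "1 + t - t / real d = (1 - t / real d) + t" by simp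
  also have "\<dots> = s * (1 - t / real d)"
    unfolding c unfolding t by (simp flip: add_divide_distrib) (simp add: algebra_simps)
  finally show "1 + t - t / real d = s * (1 - t / real d)" .
  have C: "C_star d = (s - 1)\<^sup>2 * (s + 1) / (s * (real d + s - 1))" by (simp add: C_star_def s_def)
  have "t\<^sup>2 * (real d + 2 * s) = (real d)\<^sup>2 * (s - 1)\<^sup>2 * (s * (real d + 2 * s)) / (s * (real d + s - 1)\<^sup>2)"
    unfolding t using s(2) by (simp add: power_divide power_mult_distrib)
  also have "\<dots> = (real d)\<^sup>2 * C_star d"
    unfolding s(3)[symmetric] C using s(2) pos by (simp add: power2_eq_square)
  finally show "t\<^sup>2 * (real d + 2 * s) = (real d)\<^sup>2 * C_star d" .
  show "0 < C_star d" unfolding C using s(2) pos by simp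
qed

lemma chi_integrand_measurable [measurable]: "chi_integrand H i j \<in> borel_measurable borel"
  unfolding chi_integrand_def by measurable

text \<open>The points where the pointwise inequality is tight: the origin for \<open>a = b\<close>,
  the scaled vertices for \<open>a = s * b\<close>.\<close>

definition opt_support :: "real^'k^'i \<Rightarrow> (real^'k) set" where
  "opt_support H = insert 0 (range (\<lambda>i. t_lam CARD('i) (lam_star CARD('i)) *\<^sub>R gam H i))"

context
  fixes H :: "real^'k^'i"
  assumes valid: "valid_H H" and d3: "3 \<le> CARD('i)"
begin

lemma finite_opt_support: "finite (opt_support H)"
  by (simp add: opt_support_def)

lemma inj_gam_scaled: "inj (\<lambda>i. t_lam CARD('i) (lam_star CARD('i)) *\<^sub>R gam H i)"
proof (rule injI)
  fix i j assume "t_lam CARD('i) (lam_star CARD('i)) *\<^sub>R gam H i = t_lam CARD('i) (lam_star CARD('i)) *\<^sub>R gam H j"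
  then have "gam H i \<bullet> gam H i = gam H i \<bullet> gam H j" using t_lam_facts(1)[OF d3] by simp
  then show "i = j" by (simp add: inner_gam[OF valid] split: if_splits)
qed

lemma sum_opt_support:
  fixes g :: "real^'k \<Rightarrow> 'b::comm_monoid_add"
  shows "(\<Sum>z\<in>opt_support H. g z) = g 0 + (\<Sum>i\<in>UNIV. g (t_lam CARD('i) (lam_star CARD('i)) *\<^sub>R gam H i))"
proof -
  have "0 \<notin> range (\<lambda>i. t_lam CARD('i) (lam_star CARD('i)) *\<^sub>R gam H i)"
    using t_lam_facts(1)[OF d3] gam_nonzero[OF valid] d3 by fastforce
  then show ?thesis unfolding opt_support_def
    by (simp add: sum.reindex[OF inj_gam_scaled])
qed

text \<open>The frame expansion gives \<open>x = (a - b) *\<^sub>R gam H i\<close>, and the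
  vanishing sum of the coordinates of \<open>x\<close> then fixes the scale.\<close>

lemma two_valued_imp_opt_support:
  assumes i: "1 + gam H i \<bullet> x = a" and j: "\<And>j. j \<noteq> i \<Longrightarrow> 1 + gam H j \<bullet> x = b"
    and ab: "a = b \<or> a = lam_star CARD('i) * b"
  shows "x \<in> opt_support H"
proof -
  let ?d = "real CARD('i)" and ?s = "lam_star CARD('i)"
  have g: "gam H j \<bullet> x = (b - 1) + (if j = i then a - b else 0)" for j
    using i j[of j] by auto
  have "x = (\<Sum>j\<in>UNIV. (b - 1) *\<^sub>R gam H j + (if j = i then (a - b) *\<^sub>R gam H j else 0))"
    by (subst expand_gam[OF valid, of x], intro sum.cong refl) (simp add: g scaleR_add_left)
  then have x: "x = (a - b) *\<^sub>R gam H i"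
    by (simp add: sum.distrib sum_gam[OF valid] flip: scaleR_sum_right)
  have "0 = (\<Sum>j\<in>UNIV. (b - 1) + (if j = i then a - b else 0))"
    using sum_gam_inner[OF valid, of x] by (simp add: g)
  then have tot: "?d * (b - 1) + (a - b) = 0" by (simp add: sum.distrib)
  show ?thesis
  proof (cases "a = b")
    case True
    then show ?thesis using x by (simp add: opt_support_def)
  next
    case False
    then have a: "a = ?s * b" using ab by simp
    have "b * (?d + ?s - 1) = ?d" using tot unfolding a by (simp add: algebra_simps)
    then have "b = ?d / (?d + ?s - 1)"
      using lam_star_facts(2)[OF d3] by (simp add: field_simps)
    moreover have "a - b = b * (?s - 1)" unfolding a by (simp add: algebra_simps)
    ultimately have "a - b = t_lam CARD('i) (lam_star CARD('i))" by (simp add: t_lam_def)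
    then show ?thesis using x by (auto simp: opt_support_def)
  qed
qed

end

section \<open>From the budget to the second moment and the support\<close>

context anchored_law
begin

text \<open>Adding the budget over the \<open>d * (d - 1)\<close> ordered pairs bounds the integral
  of \<open>G\<close>, which dominates \<open>(d + 2 * s)\<close> times the squared norm pointwise.
  Equality of the integrals forces the gap to vanish almost everywhere, that is, to lie in the
  equality case.\<close>

lemma budget:
  assumes d3: "3 \<le> CARD('i)" and C: "0 \<le> C" "chi_star H \<rho> \<le> ennreal C"
  defines "d \<equiv> real CARD('i)" and "s \<equiv> lam_star CARD('i)"
  shows second_moment_le: "(d + 2 * s) * (\<integral>x. (norm x)\<^sup>2 \<partial>\<rho>) \<le> d * (d - 1) * C"
    and second_moment_eq: "(d + 2 * s) * (\<integral>x. (norm x)\<^sup>2 \<partial>\<rho>) = d * (d - 1) * C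
        \<Longrightarrow> AE x in \<rho>. x \<in> opt_support H"
proof -
  define y where "y i x = 1 + gam H i \<bullet> x" for i and x :: "real^'k"
  define G where "G x = (\<Sum>i\<in>UNIV. \<Sum>j\<in>UNIV. (y j x - y i x)\<^sup>2 / y i x)" for x
  have chi: "(\<integral>\<^sup>+x. chi_integrand H i j x \<partial>\<rho>) \<le> ennreal C" if "i \<noteq> j" for i j
  proof -
    have "(\<integral>\<^sup>+x. chi_integrand H i j x \<partial>\<rho>) \<le> chi_star H \<rho>"
      unfolding chi_star_def using that by (intro SUP_upper2[of "(i, j)"]) auto
    then show ?thesis using C by simp
  qed
  have chi_meas: "chi_integrand H i j \<in> borel_measurable \<rho>" for i j
    by (intro measurable_law chi_integrand_measurable)
  \<comment> \<open>A finite integral makes the integrand finite almost everywhere; this is what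
    excludes zeros of \<open>y i\<close>.\<close>
  have "AE x in \<rho>. \<forall>ij\<in>{ij. fst ij \<noteq> snd ij}. chi_integrand H (fst ij) (snd ij) x \<noteq> \<infinity>"
  proof (rule AE_finite_allI)
    fix ij :: "'i \<times> 'i" assume "ij \<in> {ij. fst ij \<noteq> snd ij}"
    then have "(\<integral>\<^sup>+x. chi_integrand H (fst ij) (snd ij) x \<partial>\<rho>) \<noteq> \<infinity>"
      using chi[of "fst ij" "snd ij"] by (auto simp: top_unique)
    then show "AE x in \<rho>. chi_integrand H (fst ij) (snd ij) x \<noteq> \<infinity>"
      using chi_meas by (intro nn_integral_PInf_AE)
  qed simp
  then have ypos: "AE x in \<rho>. \<forall>i. 0 < y i x"
    using AE_Xd
  proof eventually_elim
    case (elim x)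
    show ?case
    proof (rule ccontr)
      assume "\<not> (\<forall>i. 0 < y i x)"
      then obtain i where "y i x \<le> 0" by (auto simp: not_less)
      then have y0: "1 + gam H i \<bullet> x = 0" using elim(2) unfolding y_def Xd_def by (simp add: antisym)
      \<comment> \<open>Finiteness where \<open>y i\<close> vanishes forces every other
        \<open>y j\<close> to vanish too, against their sum being \<open>d\<close>.\<close>
      have "gam H j \<bullet> x = -1" for j
      proof (cases "j = i")
        case False
        then have "chi_integrand H i j x \<noteq> \<infinity>" using elim(1) by force
        then have "(gam H j - gam H i) \<bullet> x = 0" using y0 by (auto simp: chi_integrand_def split: if_splits)
        then show ?thesis using y0 by (simp add: inner_diff_left)
      qed (use y0 in simp)
      then show False using sum_gam_inner[OF valid, of x] by simp
    qed
  qed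
  have ytot: "(\<Sum>i\<in>UNIV. y i x) = d" for x
    by (simp add: y_def sum.distrib sum_gam_inner[OF valid] d_def)
  have ysq: "(\<Sum>i\<in>UNIV. (y i x - 1)\<^sup>2) = (norm x)\<^sup>2" for x
    by (simp add: y_def sum_gam_inner_sq[OF valid])
  have s2: "s\<^sup>2 = real CARD('i) - 1" unfolding s_def by (rule lam_star_facts(1)[OF d3])
  have Gnn: "AE x in \<rho>. 0 \<le> G x"
    using ypos by eventually_elim (auto simp: G_def intro!: sum_nonneg divide_nonneg_pos)
  have Gmeas: "G \<in> borel_measurable \<rho>"
    unfolding G_def y_def by (intro measurable_law) measurable
  \<comment> \<open>The diagonal terms of \<open>G\<close> are zero; the case distinction keeps
    exactly the pairs that the budget controls.\<close>
  have "(\<integral>\<^sup>+x. ennreal (G x) \<partial>\<rho>)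
      = (\<integral>\<^sup>+x. (\<Sum>i\<in>UNIV. \<Sum>j\<in>UNIV. if i = j then 0 else chi_integrand H i j x) \<partial>\<rho>)"
  proof (rule nn_integral_cong_AE)
    show "AE x in \<rho>. ennreal (G x)
        = (\<Sum>i\<in>UNIV. \<Sum>j\<in>UNIV. if i = j then 0 else chi_integrand H i j x)"
      using ypos
    proof eventually_elim
      case (elim x)
      have "(if i = j then 0 else chi_integrand H i j x) = ennreal ((y j x - y i x)\<^sup>2 / y i x)" for i j
        using elim[rule_format, of i] by (simp add: chi_integrand_def y_def inner_diff_left)
      moreover have "0 \<le> (y j x - y i x)\<^sup>2 / y i x" for i j using elim[rule_format, of i] by simp
      ultimately show ?case unfolding G_def by (simp add: sum_nonneg flip: sum_ennreal)
    qed
  qed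
  also have "\<dots> = (\<Sum>i\<in>UNIV. \<Sum>j\<in>UNIV. \<integral>\<^sup>+x. (if i = j then 0 else chi_integrand H i j x) \<partial>\<rho>)"
    using chi_meas by (simp add: nn_integral_sum)
  also have "\<dots> \<le> (\<Sum>i\<in>UNIV. \<Sum>j\<in>UNIV. if (i::'i) = j then 0 else ennreal C)"
    using chi by (intro sum_mono) auto
  also have "\<dots> = (\<Sum>i\<in>UNIV. \<Sum>j\<in>UNIV. ennreal (if (i::'i) = j then 0 else C))"
    by (intro sum.cong refl) auto
  also have "\<dots> = ennreal (\<Sum>i\<in>UNIV. \<Sum>j\<in>UNIV. if (i::'i) = j then 0 else C)"
    using C(1) by (simp add: sum_nonneg flip: sum_ennreal)
  also have "(\<Sum>i\<in>UNIV. \<Sum>j\<in>UNIV. if (i::'i) = j then 0 else C) = d * (d - 1) * C"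
  proof -
    have "(\<Sum>j\<in>UNIV. if i = j then 0 else C) = (d - 1) * C" for i :: 'i
    proof -
      have "(\<Sum>j\<in>UNIV. if i = j then 0 else C) = (\<Sum>j\<in>UNIV. C - (if i = j then C else 0))"
        by (intro sum.cong refl) auto
      then show ?thesis by (simp add: sum_subtractf d_def algebra_simps)
    qed
    then show ?thesis by (simp add: d_def)
  qed
  finally have nn: "(\<integral>\<^sup>+x. ennreal (G x) \<partial>\<rho>) \<le> ennreal (d * (d - 1) * C)" .
  have Gint: "integrable \<rho> G"
    using Gmeas Gnn nn by (intro integrableI_nonneg) (auto intro: le_less_trans)
  have "ennreal (\<integral>x. G x \<partial>\<rho>) \<le> ennreal (d * (d - 1) * C)"
    using nn by (simp add: nn_integral_eq_integral[OF Gint Gnn])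
  then have GC: "(\<integral>x. G x \<partial>\<rho>) \<le> d * (d - 1) * C"
    using C(1) d3 by (subst (asm) ennreal_le_iff) (auto simp: d_def)
  have nint: "integrable \<rho> (\<lambda>x. (norm x)\<^sup>2)" by (intro integrable_continuous continuous_intros)
  have gap: "AE x in \<rho>. 0 \<le> G x - (d + 2 * s) * (norm x)\<^sup>2
      \<and> (G x - (d + 2 * s) * (norm x)\<^sup>2 = 0 \<longrightarrow> x \<in> opt_support H)"
    using ypos
  proof eventually_elim
    case (elim x)
    have two: "2 \<le> CARD('i)" using d3 by simp
    note pg = pairwise_gap[of "\<lambda>i. y i x" s, OF elim[rule_format] ytot[unfolded d_def] s2 two,
        folded d_def G_def, unfolded ysq]
    show ?case
    proof (intro conjI impI)
      show "0 \<le> G x - (d + 2 * s) * (norm x)\<^sup>2" by (rule pg(1))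
      assume "G x - (d + 2 * s) * (norm x)\<^sup>2 = 0"
      from pg(2)[OF this] show "x \<in> opt_support H"
        using two_valued_imp_opt_support[OF valid d3] unfolding y_def s_def by blast
    qed
  qed
  have diff: "(\<integral>x. G x - (d + 2 * s) * (norm x)\<^sup>2 \<partial>\<rho>)
      = (\<integral>x. G x \<partial>\<rho>) - (d + 2 * s) * (\<integral>x. (norm x)\<^sup>2 \<partial>\<rho>)"
    using Gint nint by simp
  have "0 \<le> (\<integral>x. G x - (d + 2 * s) * (norm x)\<^sup>2 \<partial>\<rho>)"
    using gap by (intro integral_nonneg_AE) auto
  then show "(d + 2 * s) * (\<integral>x. (norm x)\<^sup>2 \<partial>\<rho>) \<le> d * (d - 1) * C"
    using GC diff by linarith
  assume "(d + 2 * s) * (\<integral>x. (norm x)\<^sup>2 \<partial>\<rho>) = d * (d - 1) * C"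
  then have z: "(\<integral>x. G x - (d + 2 * s) * (norm x)\<^sup>2 \<partial>\<rho>) = 0"
    using \<open>0 \<le> (\<integral>x. G x - (d + 2 * s) * (norm x)\<^sup>2 \<partial>\<rho>)\<close> GC diff by linarith
  have "AE x in \<rho>. G x - (d + 2 * s) * (norm x)\<^sup>2 = 0"
    using integral_nonneg_eq_0_iff_AE[of \<rho> "\<lambda>x. G x - (d + 2 * s) * (norm x)\<^sup>2"] Gint nint gap z
    by auto
  then show "AE x in \<rho>. x \<in> opt_support H"
    using gap by eventually_elim auto
qed

text \<open>Testing the zero mean against each \<open>gam H j\<close> makes the weights of the
  scaled vertices equal, the second moment gives their common value \<open>q\<close>, and total mass
  one gives the weight of the origin.\<close>

lemma opt_support_determines:
  assumes d3: "3 \<le> CARD('i)" and supp: "AE x in \<rho>. x \<in> opt_support H"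
    and B: "B \<in> sets borel"
  defines "t \<equiv> t_lam CARD('i) (lam_star CARD('i))"
  defines "q \<equiv> (\<integral>x. (norm x)\<^sup>2 \<partial>\<rho>) / (t\<^sup>2 * (real CARD('i) - 1))"
  shows "measure \<rho> B = (1 - real CARD('i) * q) * indicator B 0
     + q * (\<Sum>i\<in>UNIV. indicator B (t *\<^sub>R gam H i))"
proof -
  let ?d = "real CARD('i)"
  define w where "w i = measure \<rho> {t *\<^sub>R gam H i}" for i
  define w0 where "w0 = measure \<rho> {0}"
  have fm: "finite_measure \<rho>" by unfold_locales
  have int: "(\<integral>x. f x \<partial>\<rho>) = w0 * f 0 + (\<Sum>i\<in>UNIV. w i * f (t *\<^sub>R gam H i))"
    if "f \<in> borel_measurable borel" for f :: "real^'k \<Rightarrow> real"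
    using integral_finite_support[OF fm sets_law finite_opt_support[OF valid d3] supp that]
    unfolding sum_opt_support[OF valid d3] by (simp add: w_def w0_def t_def)
  have t: "0 < t" unfolding t_def by (rule t_lam_facts(1)[OF d3])
  have weq: "w j = (\<Sum>i\<in>UNIV. w i) / ?d" for j
  proof -
    have "0 = (\<Sum>i\<in>UNIV. w i * (t * (gam H j \<bullet> gam H i)))"
      using int[of "\<lambda>x. gam H j \<bullet> x"] by (simp add: mean_inner_zero)
    also have "\<dots> = (\<Sum>i\<in>UNIV. t * ((if j = i then w i else 0) - w i / ?d))"
      by (intro sum.cong refl) (auto simp: inner_gam[OF valid] algebra_simps)
    also have "\<dots> = t * (w j - (\<Sum>i\<in>UNIV. w i) / ?d)"
      by (simp add: sum_subtractf flip: sum_distrib_left sum_divide_distrib)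
    finally show ?thesis using t by simp
  qed
  define c where "c = (\<Sum>i\<in>UNIV. w i) / ?d"
  have wc: "w i = c" for i unfolding c_def by (rule weq)
  have "(\<integral>x. (norm x)\<^sup>2 \<partial>\<rho>) = c * t\<^sup>2 * (?d - 1)"
    using int[of "\<lambda>x. (norm x)\<^sup>2"]
    by (simp add: wc power_mult_distrib power2_norm_eq_inner[of "gam H _"] inner_gam[OF valid] algebra_simps)
  then have q: "q = c" unfolding q_def using t d3 by simp
  have "1 = w0 + ?d * c" using int[of "\<lambda>_. 1"] by (simp add: wc prob_space)
  moreover have "measure \<rho> B = w0 * indicator B 0 + (\<Sum>i\<in>UNIV. c * indicator B (t *\<^sub>R gam H i))"
    using int[of "indicator B"] B by (simp add: wc sets_law sets.Int_space_eq2 sets_eq_imp_space_eq[OF sets_law])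
  ultimately show ?thesis unfolding q by (simp add: sum_distrib_left)
qed

end

subsection \<open>The optimal law\<close>

lemma nn_integral_rho_pl:
  fixes H :: "real^'k^'i"
  assumes p: "0 \<le> p" "p \<le> 1" and f: "f \<in> borel_measurable borel"
  shows "(\<integral>\<^sup>+x. f x \<partial>rho_pl H p lam)
     = f 0 * ennreal (1 - p) + (\<Sum>i\<in>UNIV. f (t_lam CARD('i) lam *\<^sub>R gam H i)) * ennreal (p / real CARD('i))"
proof -
  have "(\<integral>\<^sup>+x. f x \<partial>rho_pl H p lam)
      = f 0 * ennreal (1 - p) + (\<Sum>i\<in>UNIV. f (t_lam CARD('i) lam *\<^sub>R gam H i)) / ennreal (real CARD('i)) * ennreal p"
    unfolding rho_pl_def using p f
    by (simp add: nn_integral_distr nn_integral_pmf_of_set ennreal_of_nat_eq_real_of_nat add.commute)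
  also have "\<dots> = f 0 * ennreal (1 - p) + (\<Sum>i\<in>UNIV. f (t_lam CARD('i) lam *\<^sub>R gam H i)) * ennreal (p / real CARD('i))"
    using p by (simp add: divide_ennreal[symmetric] ennreal_times_divide ac_simps divide_ennreal_def)
  finally show ?thesis .
qed

locale optimal_design =
  fixes H :: "real^'k^'i" and C :: real
  assumes valid: "valid_H H" and d3: "3 \<le> CARD('i)" and dk: "CARD('k) + 1 = CARD('i)"
    and C: "0 < C" "C \<le> C_star CARD('i)"
begin

definition "d = real CARD('i)"
definition "s = lam_star CARD('i)"
definition "t = t_lam CARD('i) s"
definition "p = C / C_star CARD('i)"
definition "\<rho>0 = rho_pl H p s"

lemma d_ge: "3 \<le> d" using d3 by (simp add: d_def)
lemma s_gt: "1 < s" using lam_star_facts(2)[OF d3] by (simp add: s_def)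
lemma t_pos: "0 < t" using t_lam_facts(1)[OF d3] by (simp add: t_def s_def)

text \<open>The assumption \<open>C \<le> C_star CARD('i)\<close> is what makes \<open>p\<close> an
  admissible mixing weight.\<close>

lemma p_bounds: "0 < p" "p \<le> 1"
  using C t_lam_facts(5)[OF d3] by (auto simp: p_def)

lemma pt: "p * t\<^sup>2 * (d + 2 * s) = d\<^sup>2 * C"
  using t_lam_facts(4,5)[OF d3] by (simp add: p_def t_def s_def d_def mult.assoc)

lemma nn_integral_\<rho>0:
  assumes "f \<in> borel_measurable borel"
  shows "(\<integral>\<^sup>+x. f x \<partial>\<rho>0) = f 0 * ennreal (1 - p) + (\<Sum>i\<in>UNIV. f (t *\<^sub>R gam H i)) * ennreal (p / d)"
  unfolding \<rho>0_def t_def d_def using assms p_bounds by (intro nn_integral_rho_pl) auto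

lemma sets_\<rho>0: "sets \<rho>0 = sets borel" by (simp add: \<rho>0_def rho_pl_def)

lemma prob_space_\<rho>0: "prob_space \<rho>0"
  unfolding \<rho>0_def rho_pl_def by (intro prob_space.prob_space_distr prob_space_measure_pmf) simp

lemma opt_support_eq: "opt_support H = insert 0 (range (\<lambda>i. t *\<^sub>R gam H i))"
  by (simp add: opt_support_def t_def s_def)

lemma measure_\<rho>0:
  assumes "B \<in> sets borel"
  shows "measure \<rho>0 B = (1 - p) * indicator B 0 + (\<Sum>i\<in>UNIV. indicator B (t *\<^sub>R gam H i)) * (p / d)"
proof -
  interpret prob_space \<rho>0 by (rule prob_space_\<rho>0)
  have "emeasure \<rho>0 B = (\<integral>\<^sup>+x. indicator B x \<partial>\<rho>0)"
    using assms sets_\<rho>0 by simp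
  also have "\<dots> = ennreal ((1 - p) * indicator B 0 + (\<Sum>i\<in>UNIV. indicator B (t *\<^sub>R gam H i)) * (p / d))"
    using assms p_bounds d_ge
    by (simp add: nn_integral_\<rho>0 ennreal_indicator[symmetric] sum_ennreal sum_nonneg ennreal_plus
        ennreal_mult[symmetric] mult.commute flip: ennreal_plus)
  finally have "ennreal (measure \<rho>0 B)
      = ennreal ((1 - p) * indicator B 0 + (\<Sum>i\<in>UNIV. indicator B (t *\<^sub>R gam H i)) * (p / d))"
    by (simp only: emeasure_eq_measure)
  then show ?thesis
    using p_bounds d_ge
    by (subst (asm) ennreal_inj) (auto intro!: add_nonneg_nonneg mult_nonneg_nonneg divide_nonneg_pos sum_nonneg)
qed

lemma AE_\<rho>0: "AE x in \<rho>0. x \<in> opt_support H"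
proof -
  have S: "opt_support H \<in> sets borel"
    using finite_opt_support[OF valid d3] by (intro borel_closed finite_imp_closed)
  have "emeasure \<rho>0 (- opt_support H) = (\<integral>\<^sup>+x. indicator (- opt_support H) x \<partial>\<rho>0)"
    using S sets_\<rho>0 by (subst nn_integral_indicator) auto
  also have "\<dots> = 0"
    using S by (subst nn_integral_\<rho>0) (auto simp: opt_support_eq indicator_def)
  finally show ?thesis
    using S sets_\<rho>0 by (intro AE_I[where N = "- opt_support H"]) auto
qed

lemma
  fixes f :: "real^'k \<Rightarrow> 'b::{banach, second_countable_topology}"
  assumes f: "f \<in> borel_measurable borel"
  shows integrable_\<rho>0: "integrable \<rho>0 f"
    and integral_\<rho>0: "(\<integral>x. f x \<partial>\<rho>0) = (1 - p) *\<^sub>R f 0 + (p / d) *\<^sub>R (\<Sum>i\<in>UNIV. f (t *\<^sub>R gam H i))"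
proof -
  interpret prob_space \<rho>0 by (rule prob_space_\<rho>0)
  have fm: "finite_measure \<rho>0" by unfold_locales
  note supp = integral_finite_support[OF fm sets_\<rho>0 finite_opt_support[OF valid d3] AE_\<rho>0 f]
  show "integrable \<rho>0 f" by (rule supp(1))
  have w0: "measure \<rho>0 {0} = 1 - p"
  proof -
    have "t *\<^sub>R gam H i \<noteq> 0" for i
      using t_pos gam_nonzero[OF valid, of i] d3 by simp
    then show ?thesis by (subst measure_\<rho>0) auto
  qed
  have w: "measure \<rho>0 {t *\<^sub>R gam H i} = p / d" for i
  proof -
    have ne: "0 \<noteq> t *\<^sub>R gam H i"
      using t_pos gam_nonzero[OF valid, of i] d3 by simp
    have "indicat_real {t *\<^sub>R gam H i} (t *\<^sub>R gam H j) = (if j = i then 1 else 0)" for j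
      using inj_eq[OF inj_gam_scaled[OF valid d3], of j i] by (auto simp: t_def s_def indicator_def)
    then have "(\<Sum>j\<in>UNIV. indicat_real {t *\<^sub>R gam H i} (t *\<^sub>R gam H j)) = 1" by simp
    then show ?thesis using ne by (subst measure_\<rho>0) auto
  qed
  show "(\<integral>x. f x \<partial>\<rho>0) = (1 - p) *\<^sub>R f 0 + (p / d) *\<^sub>R (\<Sum>i\<in>UNIV. f (t *\<^sub>R gam H i))"
    unfolding supp(2) sum_opt_support[OF valid d3] by (simp add: w0 w scaleR_sum_right flip: t_def s_def)
qed

lemma inner_gam': "gam H i \<bullet> gam H j = (if i = j then 1 else 0) - 1 / d"
  by (simp add: inner_gam[OF valid] d_def)

lemma min_coord: "0 < 1 - t / d" "1 + t - t / d = s * (1 - t / d)"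
proof -
  have "1 - t / d = d / (d + s - 1)" using t_lam_facts(2)[OF d3] by (simp add: t_def s_def d_def)
  then show "0 < 1 - t / d" using d_ge s_gt by simp
  show "1 + t - t / d = s * (1 - t / d)" using t_lam_facts(3)[OF d3] by (simp add: t_def s_def d_def)
qed

lemma coord: "1 + gam H i \<bullet> (t *\<^sub>R gam H j) = (if i = j then s else 1) * (1 - t / d)"
  using min_coord(2) by (simp add: inner_gam' algebra_simps)

lemma anchored_\<rho>0: "\<rho>0 \<in> anchored H"
proof -
  have "opt_support H \<subseteq> Xd H"
    using min_coord(1) s_gt by (auto simp: opt_support_eq Xd_def coord simp del: inner_scaleR_right)
  then have "AE x in \<rho>0. x \<in> Xd H" using AE_\<rho>0 by auto
  then have "emeasure \<rho>0 (- Xd H) = 0"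
    by (subst (asm) AE_iff_measurable[where N = "- Xd H"])
       (auto simp: closed_Xd sets_\<rho>0 sets_eq_imp_space_eq[OF sets_\<rho>0])
  moreover have "(\<integral>x. x \<partial>\<rho>0) = 0"
    by (subst integral_\<rho>0) (auto simp: sum_gam[OF valid] simp flip: scaleR_sum_right)
  ultimately show ?thesis
    by (simp add: anchored_def prob_space_\<rho>0 sets_\<rho>0 integrable_\<rho>0)
qed

text \<open>For an ordered pair \<open>(i, j)\<close> only the atoms at the scaled vertices
  \<open>i\<close> and \<open>j\<close> contribute. Their contributions add up to exactly
  \<open>C\<close>, so every pair uses the whole budget.\<close>

lemma chi_star_\<rho>0: "chi_star H \<rho>0 \<le> ennreal C"
  unfolding chi_star_def
proof (rule SUP_least)
  fix ij :: "'i \<times> 'i" assume "ij \<in> {(i, j). i \<noteq> j}"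
  then obtain i j where ij: "ij = (i, j)" "i \<noteq> j" by auto
  let ?c = "1 - t / d"
  have c: "0 < ?c" by (rule min_coord)
  have val: "chi_integrand H i j (t *\<^sub>R gam H k)
      = ennreal ((if k = i then t\<^sup>2 / (s * ?c) else 0) + (if k = j then t\<^sup>2 / ?c else 0))" for k
  proof -
    have "(gam H j - gam H i) \<bullet> (t *\<^sub>R gam H k) = (if k = j then t else 0) - (if k = i then t else 0)"
      by (simp add: inner_diff_left inner_gam' algebra_simps)
    moreover have "(if i = k then s else 1) * ?c \<noteq> 0" using c s_gt by auto
    ultimately show ?thesis unfolding chi_integrand_def coord using ij(2) by auto
  qed
  have "(\<integral>\<^sup>+x. chi_integrand H i j x \<partial>\<rho>0)
      = (\<Sum>k\<in>UNIV. chi_integrand H i j (t *\<^sub>R gam H k)) * ennreal (p / d)"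
    by (simp add: nn_integral_\<rho>0 chi_integrand_measurable chi_integrand_def[of H i j 0])
  also have "(\<Sum>k\<in>UNIV. chi_integrand H i j (t *\<^sub>R gam H k))
      = ennreal (\<Sum>k\<in>UNIV. (if k = i then t\<^sup>2 / (s * ?c) else 0) + (if k = j then t\<^sup>2 / ?c else 0))"
    unfolding val using c s_gt by (intro sum_ennreal) auto
  also have "\<dots> * ennreal (p / d) = ennreal ((t\<^sup>2 / (s * ?c) + t\<^sup>2 / ?c) * (p / d))"
    using c s_gt p_bounds d_ge
    by (subst ennreal_mult[symmetric]) (auto intro!: sum_nonneg simp: sum.distrib)
  also have "(t\<^sup>2 / (s * ?c) + t\<^sup>2 / ?c) * (p / d) = C"
  proof -
    have ceq: "?c = d / (d + s - 1)" using t_lam_facts(2)[OF d3] by (simp add: t_def s_def d_def)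
    have key: "(s + 1) * (d + s - 1) = s * (d + 2 * s)"
      using lam_star_facts(3)[OF d3] by (simp add: s_def d_def)
    have "(t\<^sup>2 / (s * ?c) + t\<^sup>2 / ?c) * (p / d) = p * t\<^sup>2 * ((s + 1) * (d + s - 1)) / (s * d\<^sup>2)"
      unfolding ceq using s_gt d_ge by (simp add: field_simps power2_eq_square)
    also have "\<dots> = (p * t\<^sup>2 * (d + 2 * s)) / d\<^sup>2"
      unfolding key using s_gt by simp
    also have "\<dots> = C" unfolding pt using d_ge by simp
    finally show ?thesis .
  qed
  finally show "(\<integral>\<^sup>+x. chi_integrand H (fst ij) (snd ij) x \<partial>\<rho>0) \<le> ennreal C"
    by (simp add: ij)
qed

text \<open>The least trace of the inverse second-moment matrix within the budget:
  \<open>(d - 1)\<^sup>2\<close> divided by the largest second moment that \<open>budget\<close>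
  allows.\<close>

definition "V0 = (d - 1) * (d + 2 * s) / (d * C)"

text \<open>By the frame identity the second-moment matrix is a multiple of the identity. The
  nonzero atoms have equal weight and equal norm and sum to zero, so the linear part of the tilt
  integrates to zero and \<open>J_risk\<close> is constant in \<theta>.\<close>

lemma risk_\<rho>0:
  shows invertible_\<rho>0: "invertible (Sigma_mat \<rho>0)"
    and J_risk_\<rho>0: "J_risk H \<rho>0 \<theta> = V0"
proof -
  interpret L: anchored_law H \<rho>0 by (unfold_locales) (rule valid, rule anchored_\<rho>0)
  define \<sigma> where "\<sigma> = p * t\<^sup>2 / d"
  have \<sigma>: "0 < \<sigma>" using p_bounds t_pos d_ge by (simp add: \<sigma>_def)
  have Sig: "Sigma_mat \<rho>0 *v v = \<sigma> *\<^sub>R v" for v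
  proof -
    have "Sigma_mat \<rho>0 *v v = (\<integral>x. (v \<bullet> x) *\<^sub>R x \<partial>\<rho>0)" by (rule L.Sigma_mat_mult)
    also have "\<dots> = (p / d) *\<^sub>R (\<Sum>i\<in>UNIV. (v \<bullet> (t *\<^sub>R gam H i)) *\<^sub>R t *\<^sub>R gam H i)"
      by (subst integral_\<rho>0) auto
    also have "\<dots> = \<sigma> *\<^sub>R (\<Sum>i\<in>UNIV. (gam H i \<bullet> v) *\<^sub>R gam H i)"
      by (simp add: \<sigma>_def scaleR_sum_right power2_eq_square inner_commute ac_simps)
    also have "\<dots> = \<sigma> *\<^sub>R v" by (subst expand_gam[OF valid, of v]) simp
    finally show ?thesis .
  qed
  have "inj ((*v) (Sigma_mat \<rho>0))" using \<sigma> by (auto simp: inj_def Sig)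
  then show inv: "invertible (Sigma_mat \<rho>0)"
    unfolding invertible_left_inverse matrix_left_invertible_injective .
  have A: "matrix_inv (Sigma_mat \<rho>0) *v x = (1 / \<sigma>) *\<^sub>R x" for x
  proof -
    have "matrix_inv (Sigma_mat \<rho>0) *v x = matrix_inv (Sigma_mat \<rho>0) *v (Sigma_mat \<rho>0 *v ((1 / \<sigma>) *\<^sub>R x))"
      using \<sigma> by (simp add: Sig)
    then show ?thesis by (simp only: matrix_vector_mul_assoc matrix_inv_mult[OF inv] matrix_vector_mul_lid)
  qed
  have hg: "(\<Sum>i\<in>UNIV. hvec H \<theta> \<bullet> gam H i) = 0"
    using sum_gam_inner[OF valid, of "hvec H \<theta>"] by (simp add: inner_commute)
  have "J_risk H \<rho>0 \<theta> = (\<integral>x. (1 + hvec H \<theta> \<bullet> x) * ((norm x)\<^sup>2 / \<sigma>\<^sup>2) \<partial>\<rho>0)"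
    unfolding J_risk_def A by (simp add: power_divide)
  also have "\<dots> = (p / d) * (\<Sum>i\<in>UNIV. (1 + t * (hvec H \<theta> \<bullet> gam H i)) * (t\<^sup>2 * (1 - 1 / d) / \<sigma>\<^sup>2))"
    by (subst integral_\<rho>0)
       (auto simp: power_mult_distrib power2_norm_eq_inner[of "gam H _"] inner_gam')
  also have "\<dots> = (p / d) * ((d + t * (\<Sum>i\<in>UNIV. hvec H \<theta> \<bullet> gam H i)) * (t\<^sup>2 * (1 - 1 / d) / \<sigma>\<^sup>2))"
    unfolding sum_distrib_right[symmetric] sum.distrib sum_distrib_left[symmetric] by (simp add: d_def)
  also have "\<dots> = (p * t\<^sup>2 / d) * (d - 1) / \<sigma>\<^sup>2"
  proof -
    have "1 - 1 / d = (d - 1) / d" using d_ge by (simp add: field_simps)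
    then show ?thesis unfolding hg using d_ge by simp
  qed
  also have "\<dots> = (d - 1) / \<sigma>" unfolding \<sigma>_def[symmetric] using \<sigma> by (simp add: power2_eq_square)
  also have "\<sigma> = d * C / (d + 2 * s)"
  proof -
    have "p * t\<^sup>2 = d\<^sup>2 * C / (d + 2 * s)" using pt d_ge s_gt by (simp add: field_simps)
    then show ?thesis unfolding \<sigma>_def using d_ge by (simp add: power2_eq_square)
  qed
  finally show "J_risk H \<rho>0 \<theta> = V0" by (simp add: V0_def)
qed

text \<open>Chains \<open>budget\<close> with \<open>trace_inverse_lower\<close>. If
  \<open>J\<close> does not exceed \<open>V0\<close>, the second moment must be the largest
  possible, so the law is carried by \<open>opt_support H\<close> and its weights are
  determined.\<close>

lemma lower_bound:
  assumes \<rho>: "\<rho> \<in> anchored H" "chi_star H \<rho> \<le> ennreal C" and inv: "invertible (Sigma_mat \<rho>)"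
  defines "J \<equiv> (\<integral>x. (norm (matrix_inv (Sigma_mat \<rho>) *v x))\<^sup>2 \<partial>\<rho>)"
  shows "V0 \<le> J" and "J \<le> V0 \<Longrightarrow> \<rho> = \<rho>0"
proof -
  interpret L: anchored_law H \<rho> by (unfold_locales) (rule valid, rule \<rho>)
  define K where "K = d * (d - 1) * C / (d + 2 * s)"
  define S where "S = (\<integral>x. (norm x)\<^sup>2 \<partial>\<rho>)"
  have pos: "0 < d + 2 * s" "0 < d - 1" using d_ge s_gt by auto
  have K: "0 < K" using C pos by (simp add: K_def)
  have SK: "S \<le> K"
    using L.second_moment_le[OF d3 _ \<rho>(2)] C pos(1)
    by (simp add: K_def S_def d_def[symmetric] s_def[symmetric] pos_le_divide_eq mult.commute)
  have k: "real CARD('k) = d - 1" using dk by (simp add: d_def)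
  have V: "V0 = (d - 1)\<^sup>2 / K"
    using pos C by (simp add: V0_def K_def power2_eq_square)
  show "V0 \<le> J"
    using L.trace_inverse_lower[OF inv K] SK unfolding V J_def S_def k by simp
  assume "J \<le> V0"
  have "S = K"
  proof (rule ccontr)
    assume "S \<noteq> K"
    with SK have less: "S < K" by simp
    have "0 \<le> S" unfolding S_def by (intro integral_nonneg_AE) auto
    \<comment> \<open>The midpoint is positive even if \<open>S\<close> were zero, as the trace
      bound requires, and still strictly below \<open>K\<close>.\<close>
    then have K': "0 < (S + K) / 2" "S \<le> (S + K) / 2" "(S + K) / 2 < K" using less K by auto
    have "(d - 1)\<^sup>2 / ((S + K) / 2) \<le> J"
      using L.trace_inverse_lower[OF inv K'(1)] K'(2) unfolding J_def S_def k by simp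
    moreover have "(d - 1)\<^sup>2 / K < (d - 1)\<^sup>2 / ((S + K) / 2)"
      using K' K pos(2) by (intro divide_strict_left_mono mult_pos_pos) auto
    ultimately show False using \<open>J \<le> V0\<close> V by simp
  qed
  then have "(d + 2 * s) * S = d * (d - 1) * C" using pos by (simp add: K_def)
  then have supp: "AE x in \<rho>. x \<in> opt_support H"
    using L.second_moment_eq[OF d3 _ \<rho>(2)] C by (simp add: S_def d_def s_def)
  \<comment> \<open>Identifies the common vertex weight found by
    \<open>opt_support_determines\<close> with that of \<rho>0.\<close>
  have q: "S / (t\<^sup>2 * (d - 1)) = p / d"
  proof -
    have "p * t\<^sup>2 = d\<^sup>2 * C / (d + 2 * s)" using pt pos by (simp add: field_simps)
    then have "K = (p * t\<^sup>2) * (d - 1) / d"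
      using d_ge by (simp add: K_def power2_eq_square)
    then have "K = (p / d) * (t\<^sup>2 * (d - 1))" by simp
    then show ?thesis using \<open>S = K\<close> t_pos pos by simp
  qed
  show "\<rho> = \<rho>0"
  proof (rule measure_eqI)
    show "sets \<rho> = sets \<rho>0" using L.sets_law sets_\<rho>0 by simp
    fix B assume "B \<in> sets \<rho>"
    then have B: "B \<in> sets borel" using L.sets_law by simp
    interpret P: prob_space \<rho>0 by (rule prob_space_\<rho>0)
    have "measure \<rho> B = measure \<rho>0 B"
      using L.opt_support_determines[OF d3 supp B] d_ge
      by (simp add: measure_\<rho>0[OF B] q S_def[symmetric] d_def[symmetric] s_def[symmetric] t_def[symmetric])
    then show "emeasure \<rho> B = emeasure \<rho>0 B"
      by (simp add: L.emeasure_eq_measure P.emeasure_eq_measure)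
  qed
qed

section \<open>Minimax values and uniqueness\<close>

definition "feas = {\<rho> \<in> anchored H. chi_star H \<rho> \<le> ennreal C}"

lemma \<rho>0_feas: "\<rho>0 \<in> feas"
  by (simp add: feas_def anchored_\<rho>0 chi_star_\<rho>0)

text \<open>At the barycentre \<open>hvec\<close> vanishes, so the risk there is the trace of the
  inverse over \<open>n\<close>, to which \<open>lower_bound\<close> applies. A singular law has
  infinite risk and cannot attain the value.\<close>

lemma iid_lower:
  assumes \<rho>: "\<rho> \<in> feas" and n: "1 \<le> n"
  shows "ereal (V0 / real n) \<le> (SUP \<theta>\<in>prob_simplex. R_iid H n \<theta> \<rho>)"
    and "(SUP \<theta>\<in>prob_simplex. R_iid H n \<theta> \<rho>) = ereal (V0 / real n) \<Longrightarrow> \<rho> = \<rho>0"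
proof -
  let ?u = "(\<chi> i. 1 / real CARD('i)) :: real^'i"
  have \<rho>': "\<rho> \<in> anchored H" "chi_star H \<rho> \<le> ennreal C" using \<rho> by (auto simp: feas_def)
  interpret L: anchored_law H \<rho> by (unfold_locales) (rule valid, rule \<rho>')
  have sup: "R_iid H n ?u \<rho> \<le> (SUP \<theta>\<in>prob_simplex. R_iid H n \<theta> \<rho>)"
    by (intro SUP_upper uniform_in_prob_simplex)
  have eq: "R_iid H n ?u \<rho> = ereal ((\<integral>x. (norm (matrix_inv (Sigma_mat \<rho>) *v x))\<^sup>2 \<partial>\<rho>) / real n)"
    if "invertible (Sigma_mat \<rho>)"
    using L.R_iid_eq[OF that uniform_in_prob_simplex n] by (simp add: J_risk_def hvec_uniform[OF valid])
  have "ereal (V0 / real n) \<le> R_iid H n ?u \<rho>"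
  proof (cases "invertible (Sigma_mat \<rho>)")
    case True
    then show ?thesis using lower_bound(1)[OF \<rho>' True] n by (simp add: eq divide_right_mono)
  qed (simp add: R_iid_def)
  then show "ereal (V0 / real n) \<le> (SUP \<theta>\<in>prob_simplex. R_iid H n \<theta> \<rho>)" using sup by simp
  assume "(SUP \<theta>\<in>prob_simplex. R_iid H n \<theta> \<rho>) = ereal (V0 / real n)"
  with sup have le: "R_iid H n ?u \<rho> \<le> ereal (V0 / real n)" by simp
  then have inv: "invertible (Sigma_mat \<rho>)" by (auto simp: R_iid_def split: if_splits)
  from le n show "\<rho> = \<rho>0"
    by (intro lower_bound(2)[OF \<rho>' inv]) (simp add: eq[OF inv] divide_le_cancel)
qed

text \<open>The \<open>gam H i\<close> cancel when \<open>J_risk\<close> is averaged over the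
  vertices, so some vertex reaches at least the untilted value \<open>?J\<close>. The subtracted
  constant is the same at every vertex.\<close>

lemma fc_lower:
  assumes \<rho>: "\<rho> \<in> feas" and n: "1 \<le> n"
  shows "ereal ((V0 - (1 - 1 / d)) / real n) \<le> (SUP \<theta>\<in>fc_simplex n. R_fc H n \<theta> \<rho>)"
    and "(SUP \<theta>\<in>fc_simplex n. R_fc H n \<theta> \<rho>) = ereal ((V0 - (1 - 1 / d)) / real n) \<Longrightarrow> \<rho> = \<rho>0"
proof -
  let ?J = "\<integral>x. (norm (matrix_inv (Sigma_mat \<rho>) *v x))\<^sup>2 \<partial>\<rho>"
  have \<rho>': "\<rho> \<in> anchored H" "chi_star H \<rho> \<le> ennreal C" using \<rho> by (auto simp: feas_def)
  interpret L: anchored_law H \<rho> by (unfold_locales) (rule valid, rule \<rho>')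
  have sup: "R_fc H n (axis i 1) \<rho> \<le> (SUP \<theta>\<in>fc_simplex n. R_fc H n \<theta> \<rho>)" for i
    by (intro SUP_upper axis_in_fc_simplex)
  have vertex: "\<exists>i. ereal ((?J - (1 - 1 / d)) / real n) \<le> R_fc H n (axis i 1) \<rho>"
    if inv: "invertible (Sigma_mat \<rho>)"
  proof -
    note [continuous_intros] = L.continuous_matrix_vector
    have "(\<Sum>i\<in>UNIV. J_risk H \<rho> (axis i 1))
        = (\<integral>x. (\<Sum>i\<in>UNIV. (1 + gam H i \<bullet> x) * (norm (matrix_inv (Sigma_mat \<rho>) *v x))\<^sup>2) \<partial>\<rho>)"
      unfolding J_risk_def hvec_axis[OF valid]
      by (intro Bochner_Integration.integral_sum[symmetric] L.integrable_continuous continuous_intros)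
    also have "\<dots> = d * ?J"
      by (simp add: sum.distrib sum_gam_inner[OF valid] d_def flip: sum_distrib_right)
    finally have sumJ: "(\<Sum>i\<in>UNIV. J_risk H \<rho> (axis i 1)) = d * ?J" .
    have "\<exists>i. ?J \<le> J_risk H \<rho> (axis i 1)"
    proof (rule ccontr)
      assume "\<nexists>i. ?J \<le> J_risk H \<rho> (axis i 1)"
      then have "(\<Sum>i\<in>UNIV. J_risk H \<rho> (axis i 1)) < (\<Sum>i\<in>(UNIV::'i set). ?J)"
        by (intro sum_strict_mono) (auto simp: not_le)
      then show False using sumJ by (simp add: d_def)
    qed
    then obtain i where "?J \<le> J_risk H \<rho> (axis i 1)" by blast
    then show ?thesis
      using n by (intro exI[of _ i]) (simp add: L.R_fc_eq[OF inv axis_in_fc_simplex n] d_def divide_right_mono)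
  qed
  show "ereal ((V0 - (1 - 1 / d)) / real n) \<le> (SUP \<theta>\<in>fc_simplex n. R_fc H n \<theta> \<rho>)"
  proof (cases "invertible (Sigma_mat \<rho>)")
    case True
    from vertex[OF True] obtain i where "ereal ((?J - (1 - 1 / d)) / real n) \<le> R_fc H n (axis i 1) \<rho>" by blast
    moreover have "ereal ((V0 - (1 - 1 / d)) / real n) \<le> ereal ((?J - (1 - 1 / d)) / real n)"
      using lower_bound(1)[OF \<rho>' True] by (simp add: divide_right_mono)
    ultimately show ?thesis using sup[of i] by (meson order_trans)
  next
    case False
    \<comment> \<open>Any vertex will do, since the risk of a singular law is infinite at each of
      them.\<close>
    then show ?thesis using sup[of undefined] by (simp add: R_fc_def)
  qed
  assume eq: "(SUP \<theta>\<in>fc_simplex n. R_fc H n \<theta> \<rho>) = ereal ((V0 - (1 - 1 / d)) / real n)"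
  then have inv: "invertible (Sigma_mat \<rho>)"
    using sup[of undefined] by (auto simp: R_fc_def split: if_splits)
  from vertex[OF inv] obtain i where i: "ereal ((?J - (1 - 1 / d)) / real n) \<le> R_fc H n (axis i 1) \<rho>" by blast
  have "ereal ((?J - (1 - 1 / d)) / real n) \<le> ereal ((V0 - (1 - 1 / d)) / real n)"
    using order_trans[OF i sup] unfolding eq .
  then have "?J \<le> V0" using n by (simp add: divide_le_cancel)
  then show "\<rho> = \<rho>0" by (rule lower_bound(2)[OF \<rho>' inv])
qed

text \<open>The risk equals \<open>V0\<close> minus the squared norm of
  \<open>hvec H \<theta>\<close>, over \<open>n\<close>; dropping that square gives the upper bound,
  and \<open>iid_lower\<close> the converse.\<close>

lemma iid_\<rho>0:
  assumes n: "1 \<le> n"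
  shows "(SUP \<theta>\<in>prob_simplex. R_iid H n \<theta> \<rho>0) = ereal (V0 / real n)"
proof (rule antisym)
  interpret L: anchored_law H \<rho>0 by (unfold_locales) (rule valid, rule anchored_\<rho>0)
  show "(SUP \<theta>\<in>prob_simplex. R_iid H n \<theta> \<rho>0) \<le> ereal (V0 / real n)"
    using n by (intro SUP_least)
      (simp add: L.R_iid_eq[OF invertible_\<rho>0 _ n] J_risk_\<rho>0 divide_right_mono)
qed (rule iid_lower(1)[OF \<rho>0_feas n])

text \<open>Here \<rho>0 is an equalizer: its risk is the same for every admissible
  composition.\<close>

lemma fc_\<rho>0:
  assumes n: "1 \<le> n"
  shows "(SUP \<theta>\<in>fc_simplex n. R_fc H n \<theta> \<rho>0) = ereal ((V0 - (1 - 1 / d)) / real n)"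
proof (rule antisym)
  interpret L: anchored_law H \<rho>0 by (unfold_locales) (rule valid, rule anchored_\<rho>0)
  show "(SUP \<theta>\<in>fc_simplex n. R_fc H n \<theta> \<rho>0) \<le> ereal ((V0 - (1 - 1 / d)) / real n)"
    using n by (intro SUP_least)
      (simp add: L.R_fc_eq[OF invertible_\<rho>0 _ n] J_risk_\<rho>0 d_def)
qed (rule fc_lower(1)[OF \<rho>0_feas n])

lemma iid_value:
  "1 \<le> n \<Longrightarrow> (INF \<rho>\<in>feas. SUP \<theta>\<in>prob_simplex. R_iid H n \<theta> \<rho>) = ereal (V0 / real n)"
  using iid_lower(1) iid_\<rho>0 \<rho>0_feas by (intro antisym INF_greatest INF_lower2[of \<rho>0]) auto

lemma fc_value:
  "1 \<le> n \<Longrightarrow> (INF \<rho>\<in>feas. SUP \<theta>\<in>fc_simplex n. R_fc H n \<theta> \<rho>) = ereal ((V0 - (1 - 1 / d)) / real n)"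
  using fc_lower(1) fc_\<rho>0 \<rho>0_feas by (intro antisym INF_greatest INF_lower2[of \<rho>0]) auto

end

theorem theorem7p6:
  fixes H :: "real^'k^'i" and n :: nat and C :: real
  assumes "CARD('i) \<ge> 3" and "CARD('k) + 1 = CARD('i)" and "valid_H H"
    and "n \<ge> 1" and "0 < C" and "C \<le> C_star CARD('i)"
  defines "d \<equiv> real CARD('i)"
  defines "feas \<equiv> {\<rho>\<in>anchored H. chi_star H \<rho> \<le> ennreal C}"
  defines "\<rho>0 \<equiv> rho_pl H (C / C_star CARD('i)) (lam_star CARD('i))"
  defines "V_iid \<equiv> (d - 1) * (d + 2 * sqrt (d - 1)) / (real n * d * C)"
  defines "V_fc \<equiv> (1 / real n) * ((d - 1) * (d + 2 * sqrt (d - 1)) / (d * C) - (d - 1) / d)"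
  shows "(INF \<rho>\<in>feas. SUP \<theta>\<in>prob_simplex. R_iid H n \<theta> \<rho>) = ereal V_iid
       \<and> \<rho>0 \<in> feas \<and> (SUP \<theta>\<in>prob_simplex. R_iid H n \<theta> \<rho>0) = ereal V_iid
       \<and> (\<forall>\<rho>\<in>feas. (SUP \<theta>\<in>prob_simplex. R_iid H n \<theta> \<rho>) = ereal V_iid \<longrightarrow> \<rho> = \<rho>0)
       \<and> (INF \<rho>\<in>feas. SUP \<theta>\<in>fc_simplex n. R_fc H n \<theta> \<rho>) = ereal V_fc
       \<and> (SUP \<theta>\<in>fc_simplex n. R_fc H n \<theta> \<rho>0) = ereal V_fc
       \<and> (\<forall>\<rho>\<in>feas. (SUP \<theta>\<in>fc_simplex n. R_fc H n \<theta> \<rho>) = ereal V_fc \<longrightarrow> \<rho> = \<rho>0)"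
proof -
  interpret opt: optimal_design H C using assms(1-6) by unfold_locales auto
  have dd: "opt.d = d" by (simp add: opt.d_def d_def)
  have ss: "opt.s = sqrt (d - 1)" by (simp add: opt.s_def lam_star_def d_def)
  have f: "feas = opt.feas" by (simp add: feas_def opt.feas_def)
  have r: "\<rho>0 = opt.\<rho>0" by (simp add: \<rho>0_def opt.\<rho>0_def opt.p_def opt.s_def)
  have d: "0 < d" using assms(1) by (simp add: d_def)
  have v1: "V_iid = opt.V0 / real n" by (simp add: V_iid_def opt.V0_def dd ss ac_simps)
  have v2: "V_fc = (opt.V0 - (1 - 1 / opt.d)) / real n"
    using d by (simp add: V_fc_def opt.V0_def dd ss diff_divide_distrib)
  show ?thesis unfolding f r v1 v2
    using opt.iid_value opt.fc_value opt.\<rho>0_feas opt.iid_\<rho>0 opt.fc_\<rho>0 opt.iid_lower(2) opt.fc_lower(2) assms(4)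
    by blast
qed

end
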